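(* Let $\mathcal{K}=\mathbb{F}[X]/(X^2+X+1)$, and let $\overline{\mathcal{K}}$ be the corresponding para-quadratic algebra. An Okubo algebra $(\mathcal{O},*,n)$ over a field $\mathbb{F}$ of characteristic $\neq 3$ contains an idempotent if and only if it contains a subalgebra isomorphic to $\overline{\mathcal{K}}$. In this case, the centralizer $\{x\in\mathcal{O}: e*x=x*e\}$ of any idempotent $e$ is a para-quaternion subalgebra containing a subalgebra isomorphic to $\overline{\mathcal{K}}$, and two idempotents are conjugate if and only if the corresponding quaternion algebras are isomorphic. In particular, if $\mathbb{F}$ contains the cubic roots of $1$, then $(\mathcal{O},*,n)$ contains a unique conjugacy class of idempotents.
   Context: Idempotents are always nonzero. Two idempotents of $(\mathcal{O},*,n)$ are conjugate if some element of $\mathrm{Aut}(\mathcal{O},*,n)$ maps one to the other. A composition algebra over $\mathbb{F}$ is a triple $(\mathcal{C},*,n)$ with $(\mathcal{C},* )$ a not necessarily associative algebra and $n$ a nonsingular quadratic form with $n(x*y)=n(x)n(y)$; polar form $n(x,y)=n(x+y)-n(x)-n(y)$. Hurwitz algebras are the unital ones (dimensions $1,2,4,8$; dimension $2$: quadratic étale, $4$: quaternion, $8$: Cayley), with standard conjugation $\bar x=n(x,1)1-x$. Given a Hurwitz algebra $(\mathcal{C},\cdot,n)$ and an automorphism $\tau$ with $\tau^3=\mathrm{id}$, the Petersson algebra $\mathcal{C}_\tau=(\mathcal{C},*,n)$ has product $x*y=\tau(\bar x)\cdot\tau^2(\bar y)$. For $\tau=\mathrm{id}$ one obtains the para-Hurwitz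 algebra ($x\bullet y=\bar x\cdot\bar y$), called para-quadratic, para-quaternion, para-Cayley in dimensions $2,4,8$. The split Cayley algebra has a canonical basis $e_1,e_2,u_1,u_2,u_3,v_1,v_2,v_3$ where $e_1,e_2$ are orthogonal idempotents with $e_1+e_2=1$, $e_1u_i=u_i=u_ie_2$, $e_2v_i=v_i=v_ie_1$, $e_2u_i=u_ie_1=e_1v_i=v_ie_2=0$, $u_iu_{i+1}=v_{i+2}=-u_{i+1}u_i$, $v_iv_{i+1}=u_{i+2}=-v_{i+1}v_i$ (indices modulo $3$), $u_i^2=v_i^2=0$, $u_iv_i=-e_1$, $v_iu_i=-e_2$, $u_iv_j=v_iu_j=0$ for $i\ne j$. Its automorphism $\tau_{st}$ fixes $e_1,e_2$ and maps $u_i\mapsto u_{i+1}$, $v_i\mapsto v_{i+1}$. The split Okubo algebra is its Petersson algebra $\mathcal{C}_{\tau_{st}}$; an Okubo algebra is an algebra that becomes isomorphic to the split Okubo algebra after an extension of scalars. For an idempotent $e$ of $(\mathcal{O},*,n)$, the product $x\cdot y=(e*x)*(y*e)$ makes $(\mathcal{O},\cdot,n)$ a Cayley algebra with unity $e$; the quaternion algebra corresponding to $e$ is the centralizer of $e$ endowed with the product $\cdot$ (the quaternion algebra whose para-quaternion algebra is the centralizer).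
   Formalization: The final claim (a unique conjugacy class of idempotents when F contains the cubic roots of 1) is stated for Okubo algebras that contain an idempotent; Okubo algebras from degree-3 division algebras over such fields have none, so the unconditional reading fails. *)

theory Defs
  imports "HOL-Analysis.Analysis" "HOL-Computational_Algebra.Polynomial"
begin

section \<open>Algebras with a quadratic form\<close>

text \<open>The triples \<open>(\<C>, *, n)\<close> of the paper. The underlying vector space is the subspace \<open>vecs\<close>
  of an ambient vector space, so that subalgebras are structures of the same type; \<open>scl\<close>, \<open>mul\<close>
  and \<open>nrm\<close> are only meaningful on \<open>vecs\<close>. The product is not assumed associative or unital.\<close>

record ('f, 'a) qalg =
  vecs :: "'a set"
  scl :: "'f \<Rightarrow> 'a \<Rightarrow> 'a"
  mul :: "'a \<Rightarrow> 'a \<Rightarrow> 'a"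
  nrm :: "'a \<Rightarrow> 'f"

definition polar :: "('f::field, 'a::ab_group_add) qalg \<Rightarrow> 'a \<Rightarrow> 'a \<Rightarrow> 'f" where
  "polar A x y = nrm A (x + y) - nrm A x - nrm A y"

definition bilinear_product :: "('f::field, 'a::ab_group_add) qalg \<Rightarrow> bool" where
  "bilinear_product A \<longleftrightarrow>
     (\<forall>x\<in>vecs A. \<forall>y\<in>vecs A. mul A x y \<in> vecs A) \<and>
     (\<forall>x\<in>vecs A. \<forall>y\<in>vecs A. \<forall>z\<in>vecs A.
        mul A (x + y) z = mul A x z + mul A y z \<and> mul A z (x + y) = mul A z x + mul A z y) \<and>
     (\<forall>a. \<forall>x\<in>vecs A. \<forall>y\<in>vecs A.
        mul A (scl A a x) y = scl A a (mul A x y) \<and> mul A x (scl A a y) = scl A a (mul A x y))"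

definition quadratic_form :: "('f::field, 'a::ab_group_add) qalg \<Rightarrow> bool" where
  "quadratic_form A \<longleftrightarrow>
     (\<forall>a. \<forall>x\<in>vecs A. nrm A (scl A a x) = a\<^sup>2 * nrm A x) \<and>
     (\<forall>x\<in>vecs A. \<forall>y\<in>vecs A. \<forall>z\<in>vecs A. polar A (x + y) z = polar A x z + polar A y z) \<and>
     (\<forall>a. \<forall>x\<in>vecs A. \<forall>y\<in>vecs A. polar A (scl A a x) y = a * polar A x y)"

definition algebra_with_form :: "('f::field, 'a::ab_group_add) qalg \<Rightarrow> bool" where
  "algebra_with_form A \<longleftrightarrow> vector_space (scl A) \<and> module.subspace (scl A) (vecs A) \<and>
     bilinear_product A \<and> quadratic_form A"

text \<open>Nonsingular: the radical of the polar form has dimension at most one and the form is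
  anisotropic on it. Unless the characteristic is 2 and the dimension is odd (or infinite) this just
  says that the polar form is nondegenerate.\<close>

definition polar_radical :: "('f::field, 'a::ab_group_add) qalg \<Rightarrow> 'a set" where
  "polar_radical A = {x \<in> vecs A. \<forall>y\<in>vecs A. polar A x y = 0}"

definition nonsingular :: "('f::field, 'a::ab_group_add) qalg \<Rightarrow> bool" where
  "nonsingular A \<longleftrightarrow>
     (\<exists>r. \<forall>x\<in>polar_radical A. \<exists>a. x = scl A a r) \<and>
     (\<forall>x\<in>polar_radical A. x \<noteq> 0 \<longrightarrow> nrm A x \<noteq> 0)"

definition composition_algebra :: "('f::field, 'a::ab_group_add) qalg \<Rightarrow> bool" where
  "composition_algebra A \<longleftrightarrow> algebra_with_form A \<and> nonsingular A \<and>
     (\<forall>x\<in>vecs A. \<forall>y\<in>vecs A. nrm A (mul A x y) = nrm A x * nrm A y)"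


section \<open>Isomorphisms and subalgebras\<close>

definition is_iso ::
  "('f::field, 'a::ab_group_add) qalg \<Rightarrow> ('f, 'b::ab_group_add) qalg \<Rightarrow> ('a \<Rightarrow> 'b) \<Rightarrow> bool" where
  "is_iso A B \<phi> \<longleftrightarrow> bij_betw \<phi> (vecs A) (vecs B) \<and>
     (\<forall>x\<in>vecs A. \<forall>y\<in>vecs A. \<phi> (x + y) = \<phi> x + \<phi> y) \<and>
     (\<forall>a. \<forall>x\<in>vecs A. \<phi> (scl A a x) = scl B a (\<phi> x)) \<and>
     (\<forall>x\<in>vecs A. \<forall>y\<in>vecs A. \<phi> (mul A x y) = mul B (\<phi> x) (\<phi> y)) \<and>
     (\<forall>x\<in>vecs A. nrm B (\<phi> x) = nrm A x)"

definition isomorphic ::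
  "('f::field, 'a::ab_group_add) qalg \<Rightarrow> ('f, 'b::ab_group_add) qalg \<Rightarrow> bool" where
  "isomorphic A B \<longleftrightarrow> (\<exists>\<phi>. is_iso A B \<phi>)"

definition is_subalgebra :: "'a set \<Rightarrow> ('f::field, 'a::ab_group_add) qalg \<Rightarrow> bool" where
  "is_subalgebra S A \<longleftrightarrow> S \<subseteq> vecs A \<and> module.subspace (scl A) S \<and>
     (\<forall>x\<in>S. \<forall>y\<in>S. mul A x y \<in> S)"

definition restrict_to :: "('f::field, 'a::ab_group_add) qalg \<Rightarrow> 'a set \<Rightarrow> ('f, 'a) qalg" where
  "restrict_to A S = A\<lparr>vecs := S\<rparr>"

definition contains_copy ::
  "('f::field, 'a::ab_group_add) qalg \<Rightarrow> ('f, 'b::ab_group_add) qalg \<Rightarrow> bool" where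
  "contains_copy A B \<longleftrightarrow> (\<exists>S. is_subalgebra S A \<and> isomorphic (restrict_to A S) B)"


section \<open>Hurwitz, Petersson and para-Hurwitz algebras\<close>

definition is_unity :: "('f::field, 'a::ab_group_add) qalg \<Rightarrow> 'a \<Rightarrow> bool" where
  "is_unity A u \<longleftrightarrow> u \<in> vecs A \<and> u \<noteq> 0 \<and> (\<forall>x\<in>vecs A. mul A u x = x \<and> mul A x u = x)"

definition unity :: "('f::field, 'a::ab_group_add) qalg \<Rightarrow> 'a" where
  "unity A = (THE u. is_unity A u)"

definition hurwitz_algebra :: "('f::field, 'a::ab_group_add) qalg \<Rightarrow> bool" where
  "hurwitz_algebra A \<longleftrightarrow> composition_algebra A \<and> (\<exists>u. is_unity A u)"

definition quaternion_algebra :: "('f::field, 'a::ab_group_add) qalg \<Rightarrow> bool" where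
  "quaternion_algebra A \<longleftrightarrow> hurwitz_algebra A \<and> vector_space.dim (scl A) (vecs A) = 4"

definition conj_std :: "('f::field, 'a::ab_group_add) qalg \<Rightarrow> 'a \<Rightarrow> 'a" where
  "conj_std A x = scl A (polar A x (unity A)) (unity A) - x"

definition petersson :: "('f::field, 'a::ab_group_add) qalg \<Rightarrow> ('a \<Rightarrow> 'a) \<Rightarrow> ('f, 'a) qalg" where
  "petersson A \<tau> = A\<lparr>mul := \<lambda>x y. mul A (\<tau> (conj_std A x)) (\<tau> (\<tau> (conj_std A y)))\<rparr>"

definition para_hurwitz :: "('f::field, 'a::ab_group_add) qalg \<Rightarrow> ('f, 'a) qalg" where
  "para_hurwitz A = petersson A id"

definition para_quaternion :: "('f::field, 'a::ab_group_add) qalg \<Rightarrow> bool" where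
  "para_quaternion A \<longleftrightarrow>
     (\<exists>Q :: ('f, 'a) qalg. quaternion_algebra Q \<and> isomorphic A (para_hurwitz Q))"

text \<open>\<open>\<bbbF>[X]/(X\<^sup>2 + X + 1)\<close>, realised on the reduced representatives \<open>a + b X\<close>; the norm
  \<open>a\<^sup>2 - a b + b\<^sup>2\<close> is the determinant of the multiplication by \<open>a + b X\<close>.\<close>

definition alg_K :: "('f::field, 'f poly) qalg" where
  "alg_K = \<lparr>vecs = {p. degree p < 2}, scl = smult, mul = (\<lambda>p q. (p * q) mod [:1, 1, 1:]),
     nrm = (\<lambda>p. (coeff p 0)\<^sup>2 - coeff p 0 * coeff p 1 + (coeff p 1)\<^sup>2)\<rparr>"

definition para_K :: "('f::field, 'f poly) qalg" where
  "para_K = para_hurwitz alg_K"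


section \<open>The split Cayley algebra and Okubo algebras\<close>

text \<open>Labels of the canonical basis; the indices of \<open>u\<^sub>i\<close> and \<open>v\<^sub>i\<close> live in the numeral type 3,
  whose arithmetic is modulo 3.\<close>

datatype cayley_ix = Be1 | Be2 | Bu 3 | Bv 3

lemma UNIV_cayley_ix: "UNIV = {Be1, Be2} \<union> range Bu \<union> range Bv"
  using cayley_ix.exhaust by blast

instance cayley_ix :: finite
  by standard (simp add: UNIV_cayley_ix)

abbreviation bvec :: "cayley_ix \<Rightarrow> 'f::field ^ cayley_ix" where
  "bvec i \<equiv> axis i 1"

fun basis_mul :: "cayley_ix \<Rightarrow> cayley_ix \<Rightarrow> 'f::field ^ cayley_ix" where
  "basis_mul Be1 Be1 = bvec Be1"
| "basis_mul Be1 Be2 = 0"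
| "basis_mul Be2 Be1 = 0"
| "basis_mul Be2 Be2 = bvec Be2"
| "basis_mul Be1 (Bu i) = bvec (Bu i)"
| "basis_mul (Bu i) Be2 = bvec (Bu i)"
| "basis_mul Be2 (Bv i) = bvec (Bv i)"
| "basis_mul (Bv i) Be1 = bvec (Bv i)"
| "basis_mul Be2 (Bu i) = 0"
| "basis_mul (Bu i) Be1 = 0"
| "basis_mul Be1 (Bv i) = 0"
| "basis_mul (Bv i) Be2 = 0"
| "basis_mul (Bu i) (Bu j) =
     (if j = i + 1 then bvec (Bv (i + 2)) else if i = j + 1 then - bvec (Bv (j + 2)) else 0)"
| "basis_mul (Bv i) (Bv j) =
     (if j = i + 1 then bvec (Bu (i + 2)) else if i = j + 1 then - bvec (Bu (j + 2)) else 0)"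
| "basis_mul (Bu i) (Bv j) = (if i = j then - bvec Be1 else 0)"
| "basis_mul (Bv i) (Bu j) = (if i = j then - bvec Be2 else 0)"

text \<open>The norm is the one for which all basis vectors are isotropic,
  \<open>n(e\<^sub>1, e\<^sub>2) = n(u\<^sub>i, v\<^sub>i) = 1\<close>, and all other pairs of basis vectors are orthogonal;
  it is the only nonsingular multiplicative form for this product.\<close>

definition split_cayley :: "('f::field, 'f ^ cayley_ix) qalg" where
  "split_cayley = \<lparr>vecs = UNIV, scl = (*s),
     mul = (\<lambda>x y. \<Sum>i\<in>UNIV. \<Sum>j\<in>UNIV. (x $ i * y $ j) *s basis_mul i j),
     nrm = (\<lambda>x. x $ Be1 * x $ Be2 + (\<Sum>i\<in>UNIV. x $ Bu i * x $ Bv i))\<rparr>"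

fun tau_ix :: "cayley_ix \<Rightarrow> cayley_ix" where
  "tau_ix Be1 = Be1"
| "tau_ix Be2 = Be2"
| "tau_ix (Bu i) = Bu (i + 1)"
| "tau_ix (Bv i) = Bv (i + 1)"

definition tau_st :: "'f::field ^ cayley_ix \<Rightarrow> 'f ^ cayley_ix" where
  "tau_st x = (\<Sum>i\<in>UNIV. (x $ i) *s bvec (tau_ix i))"

definition split_okubo :: "('f::field, 'f ^ cayley_ix) qalg" where
  "split_okubo = petersson split_cayley tau_st"

definition field_embedding :: "('f::field \<Rightarrow> 'k::field) \<Rightarrow> bool" where
  "field_embedding h \<longleftrightarrow> h 1 = 1 \<and> (\<forall>a b. h (a + b) = h a + h b) \<and> (\<forall>a b. h (a * b) = h a * h b)"

definition is_basis :: "('f::field, 'a::ab_group_add) qalg \<Rightarrow> 'a set \<Rightarrow> bool" where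
  "is_basis A B \<longleftrightarrow> B \<subseteq> vecs A \<and> \<not> module.dependent (scl A) B \<and> module.span (scl A) B = vecs A"

text \<open>\<open>(A\<^sub>K, \<iota>)\<close> is the algebra \<open>K \<otimes>\<^sub>F A\<close>, with its product and form, together with the
  map \<open>\<iota> x = 1 \<otimes> x\<close>: up to a unique isomorphism this is the only \<open>K\<close>-algebra with a quadratic
  form and a semilinear map \<open>\<iota>\<close> taking \<open>F\<close>-bases to \<open>K\<close>-bases and preserving products and the form.\<close>

definition scalar_extension ::
  "('f::field \<Rightarrow> 'k::field) \<Rightarrow> ('f, 'a::ab_group_add) qalg \<Rightarrow> ('k, 'b::ab_group_add) qalg
     \<Rightarrow> ('a \<Rightarrow> 'b) \<Rightarrow> bool" where
  "scalar_extension h A AK \<iota> \<longleftrightarrow> algebra_with_form AK \<and>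
     (\<forall>x\<in>vecs A. \<iota> x \<in> vecs AK) \<and>
     (\<forall>x\<in>vecs A. \<forall>y\<in>vecs A. \<iota> (x + y) = \<iota> x + \<iota> y) \<and>
     (\<forall>a. \<forall>x\<in>vecs A. \<iota> (scl A a x) = scl AK (h a) (\<iota> x)) \<and>
     (\<forall>B. is_basis A B \<longrightarrow> inj_on \<iota> B \<and> is_basis AK (\<iota> ` B)) \<and>
     (\<forall>x\<in>vecs A. \<forall>y\<in>vecs A. \<iota> (mul A x y) = mul AK (\<iota> x) (\<iota> y)) \<and>
     (\<forall>x\<in>vecs A. nrm AK (\<iota> x) = h (nrm A x))"

text \<open>\<open>A\<close> is an Okubo algebra, witnessed by the field extension \<open>h : F \<rightarrow> K\<close>. HOL cannot quantify
  existentially over the type of \<open>K\<close>; a theorem assuming \<open>okubo_algebra h A\<close> for arbitrary \<open>h\<close>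
  and \<open>K\<close> covers every Okubo algebra.\<close>

definition okubo_algebra ::
  "('f::field \<Rightarrow> 'k::field) \<Rightarrow> ('f, 'a::ab_group_add) qalg \<Rightarrow> bool" where
  "okubo_algebra h A \<longleftrightarrow> algebra_with_form A \<and> field_embedding h \<and>
     (\<exists>(AK :: ('k, 'k ^ cayley_ix) qalg) \<iota>.
        scalar_extension h A AK \<iota> \<and> isomorphic AK split_okubo)"


section \<open>Idempotents\<close>

definition is_idempotent :: "('f::field, 'a::ab_group_add) qalg \<Rightarrow> 'a \<Rightarrow> bool" where
  "is_idempotent A e \<longleftrightarrow> e \<in> vecs A \<and> e \<noteq> 0 \<and> mul A e e = e"

definition conjugate :: "('f::field, 'a::ab_group_add) qalg \<Rightarrow> 'a \<Rightarrow> 'a \<Rightarrow> bool" where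
  "conjugate A e f \<longleftrightarrow> (\<exists>\<phi>. is_iso A A \<phi> \<and> \<phi> e = f)"

definition idempotent_classes :: "('f::field, 'a::ab_group_add) qalg \<Rightarrow> 'a set set" where
  "idempotent_classes A =
     {e. is_idempotent A e} // {(e, f). is_idempotent A e \<and> is_idempotent A f \<and> conjugate A e f}"

definition centralizer :: "('f::field, 'a::ab_group_add) qalg \<Rightarrow> 'a \<Rightarrow> 'a set" where
  "centralizer A e = {x \<in> vecs A. mul A e x = mul A x e}"

definition quaternion_of :: "('f::field, 'a::ab_group_add) qalg \<Rightarrow> 'a \<Rightarrow> ('f, 'a) qalg" where
  "quaternion_of A e =
     A\<lparr>vecs := centralizer A e, mul := \<lambda>x y. mul A (mul A e x) (mul A y e)\<rparr>"

end

theory Submission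
  imports Defs
begin

text \<open>
  An idempotent \<open>e\<close> turns the Okubo algebra into a Cayley algebra with unity \<open>e\<close> and an
  automorphism \<open>\<tau>\<close> of order 3, whose fixed subalgebra \<open>D\<close> is the centralizer of \<open>e\<close>. As 3 is
  invertible, the space is the orthogonal sum of \<open>D\<close> and \<open>M = ker (\<tau>\<^sup>2 + \<tau> + 1)\<close>. For an
  anisotropic \<open>v \<in> M\<close> the element \<open>w = \<tau>(v) v\<^sup>-\<^sup>1\<close> lies in \<open>D\<close>, satisfies \<open>w\<^sup>2 + w + 1 = 0\<close> and
  \<open>\<tau>(v) = w v\<close>; this gives the copy of the para-quadratic algebra. If \<open>D\<close> were equal to \<open>F[w]\<close>, then
  \<open>\<tau>\<close> would be multiplication by \<open>w\<close> or by its conjugate on \<open>M\<close>, and one of the two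
  would commute with everything for the Okubo product, which is impossible, as one sees after
  extending scalars to the split algebra. Hence there is an anisotropic
  \<open>u \<in> D\<close> orthogonal to \<open>F[w]\<close>, and two Cayley--Dickson doublings, by \<open>u\<close> and by \<open>v\<close>,
  exhaust the eight-dimensional algebra. The pair \<open>(n(u), n(v))\<close> therefore determines the algebra together
  with \<open>e\<close>. Given an isometry between two centralizers, Witt cancellation, applied first to the
  doubling by \<open>v\<close> and then to the doubling by \<open>u\<close>, shows that the same pair can be chosen for both
  idempotents. If \<open>F\<close> contains a primitive cube root of 1, the norm of \<open>F[w]\<close> is universal and the
  pair can always be taken to be \<open>(1, 1)\<close>.
\<close>

section \<open>Quadratic forms and cancellation\<close>

definition pol :: "('v::ab_group_add \<Rightarrow> 'f::field) \<Rightarrow> 'v \<Rightarrow> 'v \<Rightarrow> 'f" where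
  "pol n x y = n (x + y) - n x - n y"

locale quad_space = vector_space sc
  for sc :: "'f::field \<Rightarrow> 'v::ab_group_add \<Rightarrow> 'v" (infixr "\<odot>" 75) +
  fixes n :: "'v \<Rightarrow> 'f"
  assumes n_scale: "n (a \<odot> x) = a\<^sup>2 * n x"
    and pol_add_left: "pol n (x + y) z = pol n x z + pol n y z"
    and pol_scale_left: "pol n (a \<odot> x) y = a * pol n x y"
begin

lemma n_zero [simp]: "n 0 = 0"
  using n_scale[of 0 0] by simp

lemma pol_commute: "pol n x y = pol n y x"
  by (simp add: pol_def add.commute)

lemma pol_add_right: "pol n z (x + y) = pol n z x + pol n z y"
  by (metis pol_commute pol_add_left)

lemma pol_scale_right: "pol n y (a \<odot> x) = a * pol n y x"
  by (metis pol_commute pol_scale_left)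

lemma pol_zero_left [simp]: "pol n 0 y = 0"
  by (simp add: pol_def)

lemma pol_zero_right [simp]: "pol n y 0 = 0"
  by (simp add: pol_def)

lemma pol_minus_left: "pol n (- x) y = - pol n x y"
  using pol_add_left[of x "- x" y] by (simp add: eq_neg_iff_add_eq_0 add.commute)

lemma pol_minus_right: "pol n y (- x) = - pol n y x"
  by (metis pol_commute pol_minus_left)

lemma pol_diff_left: "pol n (x - y) z = pol n x z - pol n y z"
  using pol_add_left[of x "- y" z] by (simp add: pol_minus_left)

lemma pol_diff_right: "pol n z (x - y) = pol n z x - pol n z y"
  by (metis pol_commute pol_diff_left)

lemmas pol_simps = pol_add_left pol_add_right pol_scale_left pol_scale_right
  pol_minus_left pol_minus_right pol_diff_left pol_diff_right

lemma n_add: "n (x + y) = n x + n y + pol n x y"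
  by (simp add: pol_def)

lemma n_minus: "n (- x) = n x"
  using n_scale[of "-1" x] by simp

lemma n_diff: "n (x - y) = n x + n y - pol n x y"
  using n_add[of x "- y"] by (simp add: n_minus pol_minus_right)

lemma pol_self: "pol n x x = 2 * n x"
proof -
  have "x + x = 2 \<odot> x"
    using scale_left_distrib[of 1 1 x] by simp
  then have "n (x + x) = 4 * n x"
    by (simp add: n_scale)
  then show ?thesis
    by (simp add: pol_def)
qed

definition isometry :: "('v \<Rightarrow> 'v) \<Rightarrow> bool" where
  "isometry g \<longleftrightarrow> (\<forall>x y. g (x + y) = g x + g y) \<and> (\<forall>x. n (g x) = n x)"

lemma isometry_pol: "isometry g \<Longrightarrow> pol n (g x) (g y) = pol n x y"
  unfolding isometry_def pol_def by metis

definition reflection :: "'v \<Rightarrow> 'v \<Rightarrow> 'v" where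
  "reflection d x = x - (pol n x d / n d) \<odot> d"

lemma isometry_reflection:
  assumes "n d \<noteq> 0"
  shows "isometry (reflection d)"
  using assms unfolding isometry_def reflection_def
  by (auto simp: n_diff n_scale pol_simps power2_eq_square scale_left_distrib add_divide_distrib)

lemma isometry_extension:
  assumes anis: "\<And>x. n x = 0 \<Longrightarrow> x = 0"
    and "length xs = length ys"
    and "\<And>i. i < length xs \<Longrightarrow> n (xs ! i) = n (ys ! i)"
    and "\<And>i j. i < length xs \<Longrightarrow> j < length xs \<Longrightarrow> pol n (xs ! i) (xs ! j) = pol n (ys ! i) (ys ! j)"
  shows "\<exists>g. isometry g \<and> (\<forall>i < length xs. g (xs ! i) = ys ! i)"
  using assms(2-)
proof (induction xs arbitrary: ys rule: rev_induct)
  case Nil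
  have "isometry id"
    by (simp add: isometry_def)
  then show ?case by auto
next
  case (snoc x xs zs)
  then obtain ys y where zs: "zs = ys @ [y]" and len: "length xs = length ys"
    by (metis length_0_conv length_Suc_conv_rev length_append_singleton)
  have nxs: "n (xs ! i) = n (ys ! i)" if "i < length xs" for i
    using snoc.prems(2)[of i] that len by (simp add: zs nth_append)
  have pxs: "pol n (xs ! i) (xs ! j) = pol n (ys ! i) (ys ! j)"
    if "i < length xs" "j < length xs" for i j
    using snoc.prems(3)[of i j] that len by (simp add: zs nth_append)
  have nx: "n x = n y"
    using snoc.prems(2)[of "length xs"] len by (simp add: zs nth_append)
  have px: "pol n (xs ! i) x = pol n (ys ! i) y" if "i < length xs" for i
    using snoc.prems(3)[of i "length xs"] that len by (simp add: zs nth_append)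
  obtain g where g: "isometry g" "\<forall>i < length xs. g (xs ! i) = ys ! i"
    using snoc.IH[OF len nxs pxs] by auto
  define d where "d = y - g x"
  show ?case
  proof (cases "d = 0")
    case True
    then show ?thesis
      using g by (intro exI[of _ g]) (auto simp: zs nth_append len less_Suc_eq d_def)
  next
    case False
    then have nd: "n d \<noteq> 0"
      using anis by blast
    have ngx: "n (g x) = n y"
      using g(1) nx by (simp add: isometry_def)
    have "n d = - pol n (g x) d"
      by (simp add: d_def n_diff pol_simps pol_self ngx pol_commute[of y])
    then have 1: "reflection d (g x) = y"
      using nd by (simp add: reflection_def) (simp add: d_def)
    have 2: "reflection d (ys ! i) = ys ! i" if "i < length xs" for i
    proof -
      have "pol n (ys ! i) (g x) = pol n (ys ! i) y"
        using isometry_pol[OF g(1), of "xs ! i" x] g(2) that px by simp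
      then show ?thesis
        by (simp add: reflection_def d_def pol_simps)
    qed
    have "isometry (\<lambda>a. reflection d (g a))"
      using isometry_reflection[OF nd] g(1) by (simp add: isometry_def)
    then show ?thesis
      using g(2) 1 2 by (intro exI[of _ "\<lambda>a. reflection d (g a)"]) (auto simp: zs nth_append len less_Suc_eq)
  qed
qed

end

definition dbl_scl :: "('f \<Rightarrow> 'p \<Rightarrow> 'p) \<Rightarrow> 'f \<Rightarrow> 'p \<times> 'p \<Rightarrow> 'p \<times> 'p" where
  "dbl_scl s a x = (s a (fst x), s a (snd x))"

definition dbl_nrm :: "'f::field \<Rightarrow> ('p \<Rightarrow> 'f) \<Rightarrow> 'p \<times> 'p \<Rightarrow> 'f" where
  "dbl_nrm c q x = q (fst x) + c * q (snd x)"

lemma pol_dbl_nrm: "pol (dbl_nrm c q) x y = pol q (fst x) (fst y) + c * pol q (snd x) (snd y)"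
  by (simp add: pol_def dbl_nrm_def algebra_simps)

lemma (in quad_space) quad_space_dbl: "quad_space (dbl_scl sc) (dbl_nrm c n)"
proof
  show "dbl_nrm c n (dbl_scl sc a x) = a\<^sup>2 * dbl_nrm c n x" for a x
    by (simp add: dbl_nrm_def dbl_scl_def n_scale algebra_simps)
qed (simp_all add: dbl_scl_def scale_right_distrib scale_left_distrib pol_dbl_nrm pol_simps algebra_simps)

definition nondegenerate :: "('v::ab_group_add \<Rightarrow> 'f::field) \<Rightarrow> bool" where
  "nondegenerate n \<longleftrightarrow> (\<forall>x. (\<forall>y. pol n x y = 0) \<longrightarrow> x = 0)"

lemma (in quad_space) nondegenerate_dbl:
  assumes "nondegenerate n" "c \<noteq> 0"
  shows "nondegenerate (dbl_nrm c n)"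
  unfolding nondegenerate_def
proof (intro allI impI)
  fix x :: "'v \<times> 'v"
  assume *: "\<forall>y. pol (dbl_nrm c n) x y = 0"
  have "pol n (fst x) y = 0" for y
    using *[rule_format, of "(y, 0)"] by (simp add: pol_dbl_nrm)
  moreover have "pol n (snd x) y = 0" for y
    using *[rule_format, of "(0, y)"] assms(2) by (simp add: pol_dbl_nrm)
  ultimately show "x = 0"
    using assms(1) by (metis nondegenerate_def prod.expand fst_zero snd_zero)
qed

text \<open>Witt cancellation for the multiplicative forms: if the sum is anisotropic, a product of
  reflections moves the first summand back into place; otherwise multiplicativity suffices.\<close>

locale mult_form = quad_space sc q
  for sc :: "'f::field \<Rightarrow> 'p::ab_group_add \<Rightarrow> 'p" (infixr "\<odot>" 75) and q +
  fixes basis :: "'p list" and one :: 'p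
  assumes nondeg: "nondegenerate q"
    and mult_closed: "\<exists>z. q z = q x * q y"
    and q_one: "q one = 1"
    and span_basis: "(\<And>i. i < length basis \<Longrightarrow> pol q x (basis ! i) = 0) \<Longrightarrow> x = 0"
begin

lemma universal_if_isotropic:
  assumes "x \<noteq> 0" "q x = 0"
  shows "\<exists>z. q z = c"
proof -
  obtain y where y: "pol q x y \<noteq> 0"
    using nondeg assms(1) unfolding nondegenerate_def by blast
  have "q (y + ((c - q y) / pol q x y) \<odot> x) = c"
    using y assms(2) by (simp add: n_add n_scale pol_simps pol_commute[of y x])
  then show ?thesis by blast
qed

lemma quotient_value:
  assumes "q y \<noteq> 0"
  shows "\<exists>z. q z = q x / q y"
proof -
  have "q ((1 / q y) \<odot> y) = 1 / q y"
    using assms by (simp add: n_scale power2_eq_square field_simps)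
  then show ?thesis
    using mult_closed[of x "(1 / q y) \<odot> y"] by auto
qed

theorem cancellation:
  assumes b: "b \<noteq> 0" and b': "b' \<noteq> 0"
    and add: "\<And>x y. T (x + y) = T x + T y"
    and iso: "\<And>x. dbl_nrm b' q (T x) = dbl_nrm b q x"
    and bij: "bij T"
  shows "\<exists>d. b = b' * q d"
proof (cases "\<exists>x. x \<noteq> 0 \<and> q x = 0")
  case True
  then obtain d where "q d = b / b'"
    using universal_if_isotropic by blast
  then show ?thesis
    using b' by (intro exI[of _ d]) simp
next
  case False
  then have anis: "x = 0" if "q x = 0" for x
    using that by blast
  have rat: "\<exists>x y. q x \<noteq> 0 \<and> q y \<noteq> 0 \<and> - c = q x / q y"
    if z: "z \<noteq> 0" "dbl_nrm c q z = 0" and c: "c \<noteq> 0" for c z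
  proof -
    have "q (fst z) + c * q (snd z) = 0"
      using z(2) by (simp add: dbl_nrm_def)
    moreover from this have "q (snd z) \<noteq> 0"
      using z(1) anis by (metis add.right_neutral mult_zero_right prod.expand fst_zero snd_zero)
    ultimately show ?thesis
      using c by (intro exI[of _ "fst z"] exI[of _ "snd z"])
        (auto simp: eq_divide_eq add_eq_0_iff2)
  qed
  show ?thesis
  proof (cases "\<exists>z. z \<noteq> 0 \<and> dbl_nrm b q z = 0")
    case True
    then obtain z where z: "z \<noteq> 0" "dbl_nrm b q z = 0"
      by blast
    moreover have "T 0 = 0"
      using add[of 0 0] by simp
    ultimately have Tz: "T z \<noteq> 0" "dbl_nrm b' q (T z) = 0"
      using bij iso by (metis bij_pointE, simp)
    obtain x y where xy: "q x \<noteq> 0" "q y \<noteq> 0" "- b = q x / q y"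
      using rat[OF z b] by blast
    obtain x' y' where xy': "q x' \<noteq> 0" "q y' \<noteq> 0" "- b' = q x' / q y'"
      using rat[OF Tz b'] by blast
    obtain s where s: "q s = q x * q y'"
      using mult_closed by metis
    obtain t where t: "q t = q y * q x'"
      using mult_closed by metis
    obtain d where d: "q d = q s / q t"
      using quotient_value[of t s] t xy xy' by auto
    have "b = - (q x / q y)" "b' = - (q x' / q y')"
      using xy(3) xy'(3) by (metis minus_minus)+
    then have "b = b' * q d"
      using xy xy' by (simp add: d s t)
    then show ?thesis by blast
  next
    case False
    interpret D: quad_space "dbl_scl sc" "dbl_nrm b' q"
      by (rule quad_space_dbl)
    have polT: "pol (dbl_nrm b' q) (T x) (T y) = pol (dbl_nrm b q) x y" for x y
      unfolding pol_def by (metis add iso)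
    let ?ys = "map (\<lambda>x. (x, 0)) basis"
    have T0: "T 0 = 0"
      using add[of 0 0] by simp
    have anis': "x = 0" if "dbl_nrm b' q x = 0" for x
      using that False iso T0 bij by (metis bij_pointE)
    obtain g where g: "D.isometry g" "\<forall>i < length basis. g (T (?ys ! i)) = ?ys ! i"
      using D.isometry_extension[OF anis', of "map T ?ys" ?ys]
      by (auto simp: polT iso) (auto simp: pol_dbl_nrm dbl_nrm_def)
    define z where "z = g (T (0, one))"
    have "pol q (fst z) (basis ! i) = 0" if "i < length basis" for i
    proof -
      have "pol (dbl_nrm b' q) z (?ys ! i) = pol (dbl_nrm b' q) (g (T (0, one))) (g (T (?ys ! i)))"
        using g(2) that by (simp add: z_def)
      also have "\<dots> = pol (dbl_nrm b q) (0, one) (?ys ! i)"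
        by (simp add: D.isometry_pol[OF g(1)] polT)
      finally show ?thesis
        using that by (simp add: pol_dbl_nrm)
    qed
    then have "fst z = 0"
      by (rule span_basis)
    moreover have "dbl_nrm b' q z = b"
    proof -
      have "dbl_nrm b' q z = dbl_nrm b q (0, one)"
        using g(1) unfolding z_def D.isometry_def by (simp only: iso)
      then show ?thesis
        by (simp add: dbl_nrm_def q_one)
    qed
    ultimately show ?thesis
      by (auto simp: dbl_nrm_def)
  qed
qed

end

section \<open>Hurwitz algebras and doubling\<close>

locale bilinear_op = vector_space sc
  for sc :: "'f::field \<Rightarrow> 'v::ab_group_add \<Rightarrow> 'v" (infixr "\<odot>" 75) +
  fixes m :: "'v \<Rightarrow> 'v \<Rightarrow> 'v" (infixl "\<cdot>" 70)
  assumes m_add_left: "(x + y) \<cdot> z = x \<cdot> z + y \<cdot> z"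
    and m_add_right: "z \<cdot> (x + y) = z \<cdot> x + z \<cdot> y"
    and m_scale_left: "(a \<odot> x) \<cdot> y = a \<odot> (x \<cdot> y)"
    and m_scale_right: "x \<cdot> (a \<odot> y) = a \<odot> (x \<cdot> y)"
begin

lemma m_zero [simp]: "0 \<cdot> x = 0" "x \<cdot> 0 = 0"
  using m_scale_left[of 0 0 x] m_scale_right[of x 0 0] by simp_all

lemma m_minus_left: "(- x) \<cdot> y = - (x \<cdot> y)"
  using m_scale_left[of "-1" x y] by simp

lemma m_minus_right: "x \<cdot> (- y) = - (x \<cdot> y)"
  using m_scale_right[of x "-1" y] by simp

lemma m_diff_left: "(x - y) \<cdot> z = x \<cdot> z - y \<cdot> z"
  using m_add_left[of x "- y" z] by (simp add: m_minus_left)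

lemma m_diff_right: "z \<cdot> (x - y) = z \<cdot> x - z \<cdot> y"
  using m_add_right[of z x "- y"] by (simp add: m_minus_right)

lemmas m_simps = m_add_left m_add_right m_scale_left m_scale_right
  m_minus_left m_minus_right m_diff_left m_diff_right

end

locale hurwitz = quad_space sc n + bilinear_op sc m
  for sc :: "'f::field \<Rightarrow> 'v::ab_group_add \<Rightarrow> 'v" (infixr "\<odot>" 75)
    and n :: "'v \<Rightarrow> 'f" and m :: "'v \<Rightarrow> 'v \<Rightarrow> 'v" (infixl "\<cdot>" 70) +
  fixes e :: 'v
  assumes n_mult: "n (x \<cdot> y) = n x * n y"
    and nondeg: "nondegenerate n"
    and unit_left [simp]: "e \<cdot> x = x"
    and unit_right [simp]: "x \<cdot> e = x"
    and n_e [simp]: "n e = 1"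
begin

lemma eqI_pol: "(\<And>z. pol n x z = pol n y z) \<Longrightarrow> x = y"
  using nondeg unfolding nondegenerate_def by (metis pol_diff_left right_minus_eq)

lemma pol_mult_left: "pol n (x \<cdot> y) (x \<cdot> z) = n x * pol n y z"
  by (simp add: pol_def n_mult algebra_simps flip: m_add_right)

lemma pol_mult_right: "pol n (x \<cdot> z) (y \<cdot> z) = pol n x y * n z"
  by (simp add: pol_def n_mult algebra_simps flip: m_add_left)

lemma pol_exchange: "pol n (x \<cdot> y) (z \<cdot> w) + pol n (x \<cdot> w) (z \<cdot> y) = pol n x z * pol n y w"
proof -
  have "pol n (x \<cdot> (y + w)) (z \<cdot> (y + w)) = pol n x z * n (y + w)"
    by (rule pol_mult_right)
  then show ?thesis
    by (simp add: m_simps pol_simps pol_mult_right n_add pol_commute[of w y] algebra_simps)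
qed

definition cj :: "'v \<Rightarrow> 'v" where
  "cj x = pol n x e \<odot> e - x"

lemma cj_add: "cj (x + y) = cj x + cj y"
  by (simp add: cj_def pol_simps scale_left_distrib)

lemma cj_scale: "cj (a \<odot> x) = a \<odot> cj x"
  by (simp add: cj_def pol_simps scale_right_diff_distrib)

lemma cj_e [simp]: "cj e = e"
  using scale_left_diff_distrib[of 2 1 e] by (simp add: cj_def pol_self)

lemma cj_cj [simp]: "cj (cj x) = x"
proof -
  have "pol n (cj x) e = pol n x e"
    by (simp add: cj_def pol_simps pol_self)
  then show ?thesis
    by (simp add: cj_def)
qed

lemma cj_orth: "pol n x e = 0 \<Longrightarrow> cj x = - x"
  by (simp add: cj_def)

lemma adj_left: "pol n (x \<cdot> y) z = pol n y (cj x \<cdot> z)"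
  using pol_exchange[of x y e z] by (simp add: cj_def m_simps pol_simps pol_commute algebra_simps)

lemma adj_right: "pol n (x \<cdot> y) z = pol n x (z \<cdot> cj y)"
  using pol_exchange[of x y z e] by (simp add: cj_def m_simps pol_simps pol_commute algebra_simps)

lemma n_cj [simp]: "n (cj x) = n x"
  by (simp add: cj_def n_diff n_scale pol_simps power2_eq_square pol_commute[of e])

lemma pol_cj: "pol n (cj x) (cj y) = pol n x y"
  by (simp add: pol_def flip: cj_add)

lemma cj_mult_cancel: "cj x \<cdot> (x \<cdot> y) = n x \<odot> y"
proof (rule eqI_pol)
  fix z
  show "pol n (cj x \<cdot> (x \<cdot> y)) z = pol n (n x \<odot> y) z"
    using adj_left[of "cj x" "x \<cdot> y" z] by (simp add: pol_mult_left pol_simps)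
qed

lemma mult_cj_cancel: "(y \<cdot> x) \<cdot> cj x = n x \<odot> y"
proof (rule eqI_pol)
  fix z
  show "pol n ((y \<cdot> x) \<cdot> cj x) z = pol n (n x \<odot> y) z"
    using adj_right[of "y \<cdot> x" "cj x" z] by (simp add: pol_mult_right pol_simps)
qed

lemma mult_cancel_cj: "x \<cdot> (cj x \<cdot> y) = n x \<odot> y"
  using cj_mult_cancel[of "cj x" y] by simp

lemma cj_cancel_mult: "(y \<cdot> cj x) \<cdot> x = n x \<odot> y"
  using mult_cj_cancel[of y "cj x"] by simp

lemma mult_cj_self: "x \<cdot> cj x = n x \<odot> e"
  using mult_cancel_cj[of x e] by simp

lemma cj_mult: "cj (x \<cdot> y) = cj y \<cdot> cj x"
proof (rule eqI_pol)
  fix z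
  have "pol n (cj (x \<cdot> y)) z = pol n (x \<cdot> y) (cj z)"
    using pol_cj[of "x \<cdot> y" "cj z"] by simp
  also have "\<dots> = pol n y (cj x \<cdot> cj z)"
    by (rule adj_left)
  also have "\<dots> = pol n (cj y \<cdot> cj x) z"
    using adj_left[of "cj y" "cj x" z] adj_right[of "y" z "cj x"]
    by (simp add: pol_commute)
  finally show "pol n (cj (x \<cdot> y)) z = pol n (cj y \<cdot> cj x) z" .
qed

lemma cj_lin_left: "x \<cdot> (cj y \<cdot> z) + y \<cdot> (cj x \<cdot> z) = pol n x y \<odot> z"
  using mult_cancel_cj[of "x + y" z]
  by (simp add: cj_add m_simps mult_cancel_cj n_add scale_left_distrib algebra_simps)

lemma cj_lin_right: "(z \<cdot> cj x) \<cdot> y + (z \<cdot> cj y) \<cdot> x = pol n x y \<odot> z"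
  using cj_cancel_mult[of z "x + y"]
  by (simp add: cj_add m_simps cj_cancel_mult n_add scale_left_distrib algebra_simps)

lemma cj_lin: "x \<cdot> cj y + y \<cdot> cj x = pol n x y \<odot> e"
  using cj_lin_left[of x y e] by simp

context
  fixes D v
  assumes D_e: "e \<in> D" and D_mult: "\<And>x y. x \<in> D \<Longrightarrow> y \<in> D \<Longrightarrow> x \<cdot> y \<in> D"
    and D_cj: "\<And>x. x \<in> D \<Longrightarrow> cj x \<in> D"
    and orth: "\<And>x. x \<in> D \<Longrightarrow> pol n x v = 0"
begin

lemma cj_v: "cj v = - v"
  by (simp add: cj_orth pol_commute D_e orth)

lemma dbl_commute: "b \<in> D \<Longrightarrow> b \<cdot> v = v \<cdot> cj b"
  using cj_lin[of b v] by (simp add: cj_v orth m_simps)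

lemma dbl_orth: "a \<in> D \<Longrightarrow> b \<in> D \<Longrightarrow> pol n a (b \<cdot> v) = 0"
  by (metis D_cj D_mult adj_left orth pol_commute)

lemma cj_dbl: "b \<in> D \<Longrightarrow> cj (b \<cdot> v) = - (b \<cdot> v)"
  by (simp add: cj_orth pol_commute D_e dbl_orth)

lemma dbl_left: 
  assumes "a \<in> D" "d \<in> D"
  shows "a \<cdot> (d \<cdot> v) = (d \<cdot> a) \<cdot> v"
proof -
  have "a \<cdot> (v \<cdot> cj d) = v \<cdot> (cj a \<cdot> cj d)"
    using cj_lin_left[of a v "cj d"] by (simp add: cj_v orth m_simps assms)
  then show ?thesis
    using assms by (simp add: dbl_commute D_mult cj_mult)
qed

lemma dbl_right: "c \<in> D \<Longrightarrow> (b \<cdot> v) \<cdot> c = (b \<cdot> cj c) \<cdot> v"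
  using cj_lin_right[of b v c] by (simp add: cj_v orth m_simps pol_commute)

lemma dbl_both:
  assumes "b \<in> D" "d \<in> D"
  shows "(b \<cdot> v) \<cdot> (d \<cdot> v) = - (n v \<odot> (cj d \<cdot> b))"
proof -
  have "((d \<cdot> b) \<cdot> v) \<cdot> v = - (n v \<odot> (d \<cdot> b))"
    using mult_cj_cancel[of "d \<cdot> b" v] by (simp add: cj_v m_simps minus_equation_iff)
  moreover have "- ((b \<cdot> v) \<cdot> (d \<cdot> v)) - (b \<cdot> (d \<cdot> v)) \<cdot> v = pol n v (d \<cdot> v) \<odot> b"
    using cj_lin_right[of b v "d \<cdot> v"] assms by (simp add: cj_v cj_dbl m_simps)
  moreover have "pol n v (d \<cdot> v) = n v * pol n d e"
    using pol_mult_right[of d v e] by (simp add: pol_commute mult.commute)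
  ultimately show ?thesis
    using assms by (simp add: dbl_left cj_def m_simps scale_right_diff_distrib algebra_simps)
qed

lemma dbl_mult:
  assumes "a \<in> D" "b \<in> D" "c \<in> D" "d \<in> D"
  shows "(a + b \<cdot> v) \<cdot> (c + d \<cdot> v) = (a \<cdot> c - n v \<odot> (cj d \<cdot> b)) + (d \<cdot> a + b \<cdot> cj c) \<cdot> v"
  using assms by (simp add: m_simps dbl_left dbl_right dbl_both)

lemma n_dbl: "a \<in> D \<Longrightarrow> b \<in> D \<Longrightarrow> n (a + b \<cdot> v) = n a + n v * n b"
  by (simp add: n_add dbl_orth n_mult)

lemma cj_dbl_add: "b \<in> D \<Longrightarrow> cj (a + b \<cdot> v) = cj a - b \<cdot> v"
  by (simp add: cj_add cj_dbl)

end

end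

section \<open>Idempotents of Okubo algebras\<close>

locale okubo_idem = quad_space sc n + star: bilinear_op sc st
  for sc :: "'f::field \<Rightarrow> 'v::ab_group_add \<Rightarrow> 'v" (infixr "\<odot>" 75)
    and n :: "'v \<Rightarrow> 'f" and st :: "'v \<Rightarrow> 'v \<Rightarrow> 'v" (infixl "\<star>" 70) +
  fixes e :: 'v
  assumes sym1: "(x \<star> y) \<star> x = n x \<odot> y"
    and sym2: "x \<star> (y \<star> x) = n x \<odot> y"
    and nondeg: "nondegenerate n"
    and centre: "(\<And>x. p \<star> x = x \<star> p) \<Longrightarrow> p = 0"
    and three: "(3::'f) \<noteq> 0"
    and idem: "e \<star> e = e" and e_nonzero: "e \<noteq> 0"
begin

lemma n_star: "n (x \<star> y) = n x * n y"
proof (cases "x = 0")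
  case False
  have "n (x \<star> y) \<odot> x = (n x * n y) \<odot> x"
    using sym1[of "x \<star> y" x] by (auto simp: sym1 star.m_simps sym2)
  then show ?thesis
    using False by (simp only: scale_cancel_right) simp
qed simp

lemma sym1_lin: "(x \<star> y) \<star> z + (z \<star> y) \<star> x = pol n x z \<odot> y"
  using sym1[of "x + z" y]
  by (simp add: star.m_simps sym1 n_add scale_left_distrib algebra_simps)

lemma sym2_lin: "x \<star> (y \<star> z) + z \<star> (y \<star> x) = pol n x z \<odot> y"
  using sym2[of "x + z" y]
  by (simp add: star.m_simps sym2 n_add scale_left_distrib algebra_simps)

lemma norm_e: "n e = 1"
proof -
  have "n e \<odot> e = 1 \<odot> e"
    using sym1[of e e] by (simp add: idem)
  then show ?thesis
    using e_nonzero by (simp only: scale_cancel_right) simp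
qed

lemma e_cancel [simp]: "(e \<star> x) \<star> e = x" "e \<star> (x \<star> e) = x"
  by (simp_all add: sym1 sym2 norm_e)

definition dot :: "'v \<Rightarrow> 'v \<Rightarrow> 'v" (infixl "\<cdot>" 70) where
  "x \<cdot> y = (e \<star> x) \<star> (y \<star> e)"

sublocale hurwitz sc n dot e
  by unfold_locales
    (simp_all add: dot_def star.m_simps n_star norm_e nondeg idem)

definition tau :: "'v \<Rightarrow> 'v" where
  "tau x = e \<star> (e \<star> x)"

lemma tau_add: "tau (x + y) = tau x + tau y"
  and tau_scale: "tau (a \<odot> x) = a \<odot> tau x"
  and tau_minus: "tau (- x) = - tau x"
  and tau_diff: "tau (x - y) = tau x - tau y"
  and tau_e [simp]: "tau e = e"
  and n_tau: "n (tau x) = n x"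
  by (simp_all add: tau_def star.m_simps idem n_star norm_e)

lemmas tau_simps = tau_add tau_scale tau_minus tau_diff

lemma pol_tau: "pol n (tau x) (tau y) = pol n x y"
  by (simp add: pol_def n_tau flip: tau_add)

lemma tau_eq: "tau x = pol n x e \<odot> e - x \<star> e"
  using sym2_lin[of e e x] by (simp add: tau_def idem pol_commute eq_diff_eq)

lemma tau_cj: "tau (cj x) = cj (tau x)"
proof -
  have "pol n (tau x) e = pol n x e"
    using pol_tau[of x e] by simp
  then show ?thesis
    by (simp add: cj_def tau_simps)
qed

lemma star_e: "x \<star> e = tau (cj x)"
proof -
  have "tau (cj x) = pol n x e \<odot> e - tau x"
    by (simp add: cj_def tau_simps)
  then show ?thesis
    by (simp add: tau_eq)
qed

lemma e_star_e: "e \<star> x = pol n x e \<odot> e - (x \<star> e) \<star> e"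
  using sym1_lin[of e e x] by (simp add: idem pol_commute eq_diff_eq)

lemma e_star: "e \<star> x = tau (tau (cj x))"
proof -
  have "(x \<star> e) \<star> e = tau (cj (tau (cj x)))"
    by (simp add: star_e)
  also have "\<dots> = tau (tau x)"
    by (simp flip: tau_cj)
  finally have "e \<star> x = pol n x e \<odot> e - tau (tau x)"
    by (simp add: e_star_e)
  then show ?thesis
    by (simp add: cj_def tau_simps)
qed

lemma tau3 [simp]: "tau (tau (tau x)) = x"
  using e_cancel(1)[of x] unfolding star_e e_star by (simp flip: tau_cj)

lemma tau_star: "tau (x \<star> y) = tau x \<star> tau y"
proof -
  have a: "e \<star> (x \<star> y) = pol n y e \<odot> x - y \<star> (x \<star> e)"
    using sym2_lin[of e x y] by (simp add: pol_commute eq_diff_eq)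
  have b: "e \<star> (y \<star> (x \<star> e)) = pol n x e \<odot> y - (x \<star> e) \<star> (y \<star> e)"
  proof -
    have "pol n (x \<star> e) e = pol n x e"
      unfolding star_e using pol_tau[of "cj x" e] pol_cj[of x e] by simp
    then show ?thesis
      using sym2_lin[of e y "x \<star> e"] by (simp add: pol_commute eq_diff_eq)
  qed
  have "tau (x \<star> y) = pol n y e \<odot> (e \<star> x) - pol n x e \<odot> y + (x \<star> e) \<star> (y \<star> e)"
    by (simp add: tau_def a b star.m_simps)
  moreover have "tau x \<star> tau y = pol n x e \<odot> pol n y e \<odot> e - pol n x e \<odot> y
      - pol n y e \<odot> ((x \<star> e) \<star> e) + (x \<star> e) \<star> (y \<star> e)"
    unfolding tau_eq by (simp add: star.m_simps idem algebra_simps scale_right_diff_distrib)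
  ultimately show ?thesis
    by (simp add: e_star_e scale_right_diff_distrib mult.commute)
qed

lemma tau_dot: "tau (x \<cdot> y) = tau x \<cdot> tau y"
  by (simp add: dot_def tau_star)

lemma star_eq: "x \<star> y = tau (cj x) \<cdot> tau (tau (cj y))"
proof -
  have "x \<star> y = (x \<star> e) \<cdot> (e \<star> y)"
    by (simp add: dot_def)
  then show ?thesis
    by (simp only: star_e e_star)
qed

definition D :: "'v set" where "D = {x. tau x = x}"

definition M :: "'v set" where "M = {x. \<forall>d\<in>D. pol n d x = 0}"

lemma D_iff: "x \<in> D \<longleftrightarrow> e \<star> x = x \<star> e"
proof -
  have "e \<star> x = x \<star> e \<longleftrightarrow> cj (tau (tau x)) = cj (tau x)"
    by (simp add: e_star star_e tau_cj)
  also have "\<dots> \<longleftrightarrow> tau (tau x) = tau x"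
    by (metis cj_cj)
  also have "\<dots> \<longleftrightarrow> tau x = x"
    by (metis tau3)
  finally show ?thesis
    by (simp add: D_def)
qed

lemma D_closed:
  "e \<in> D" "x \<in> D \<Longrightarrow> y \<in> D \<Longrightarrow> x \<cdot> y \<in> D" "x \<in> D \<Longrightarrow> cj x \<in> D"
  "x \<in> D \<Longrightarrow> y \<in> D \<Longrightarrow> x + y \<in> D" "x \<in> D \<Longrightarrow> y \<in> D \<Longrightarrow> x - y \<in> D" "x \<in> D \<Longrightarrow> a \<odot> x \<in> D"
  by (simp_all add: D_def tau_dot tau_cj tau_simps)

lemma M_closed:
  "x \<in> M \<Longrightarrow> y \<in> M \<Longrightarrow> x + y \<in> M" "x \<in> M \<Longrightarrow> y \<in> M \<Longrightarrow> x - y \<in> M" "x \<in> M \<Longrightarrow> a \<odot> x \<in> M"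
  by (simp_all add: M_def pol_simps)

lemma tau_M: assumes "x \<in> M" shows "tau x \<in> M"
proof -
  have "pol n d (tau x) = 0" if "d \<in> D" for d
    using pol_tau[of d x] that assms by (simp add: M_def D_def)
  then show ?thesis
    by (simp add: M_def)
qed

lemma D_mult_M: assumes "x \<in> D" "y \<in> M" shows "x \<cdot> y \<in> M"
proof -
  have "pol n d (x \<cdot> y) = 0" if "d \<in> D" for d
    using adj_left[of x y d] that assms by (simp add: M_def D_closed pol_commute[of _ "_ \<cdot> _"] pol_commute[of y])
  then show ?thesis
    by (simp add: M_def)
qed

lemma DM_decomp: obtains d y where "d \<in> D" "y \<in> M" "x = d + y" "tau (tau y) + tau y + y = 0"
proof -
  define t where "t = x + tau x + tau (tau x)"
  define y where "y = x - (1/3) \<odot> t"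
  have t: "t \<in> D"
    by (simp add: D_def t_def tau_simps)
  have "pol n d y = 0" if "d \<in> D" for d
  proof -
    have "pol n d (tau z) = pol n d z" for z
      using pol_tau[of d z] that by (simp add: D_def)
    then have "pol n d t = 3 * pol n d x"
      by (simp add: t_def pol_simps)
    then show ?thesis
      using three by (simp add: y_def pol_simps)
  qed
  moreover have "tau (tau y) + tau y + y = 0"
  proof -
    have "tau t = t" using t by (simp add: D_def)
    then have "tau (tau y) + tau y + y = t - ((1/3) \<odot> t + (1/3) \<odot> t + (1/3) \<odot> t)"
      by (simp add: y_def tau_simps t_def[symmetric]) (simp add: t_def)
    also have "(1/3) \<odot> t + (1/3) \<odot> t + (1/3) \<odot> t = (1/3 + 1/3 + 1/3) \<odot> t"
      by (simp only: scale_left_distrib)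
    also have "1/3 + 1/3 + 1/3 = (1::'f)"
      using three by (simp add: field_simps)
    finally show ?thesis by simp
  qed
  moreover have "x = (1/3) \<odot> t + y"
    by (simp add: y_def)
  ultimately show ?thesis
    using that[of "(1/3) \<odot> t" y] D_closed(6)[OF t] by (simp only: M_def mem_Collect_eq) blast
qed

lemma D_nondeg: "d \<in> D \<Longrightarrow> (\<And>x. x \<in> D \<Longrightarrow> pol n d x = 0) \<Longrightarrow> d = 0"
proof (rule eqI_pol)
  fix z assume d: "d \<in> D" "\<And>x. x \<in> D \<Longrightarrow> pol n d x = 0"
  obtain x y where "x \<in> D" "y \<in> M" "z = x + y"
    by (rule DM_decomp)
  then show "pol n d z = pol n 0 z"
    using d by (simp add: pol_simps M_def)
qed

lemma M_nondeg: "y \<in> M \<Longrightarrow> (\<And>x. x \<in> M \<Longrightarrow> pol n y x = 0) \<Longrightarrow> y = 0"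
proof (rule eqI_pol)
  fix z assume d: "y \<in> M" "\<And>x. x \<in> M \<Longrightarrow> pol n y x = 0"
  obtain x x' where "x \<in> D" "x' \<in> M" "z = x + x'"
    by (rule DM_decomp)
  then show "pol n y z = pol n 0 z"
    using d by (simp add: pol_simps M_def pol_commute[of y])
qed

lemma M_tau: assumes "y \<in> M" shows "tau (tau y) = - tau y - y"
proof -
  obtain d x where dx: "d \<in> D" "x \<in> M" "y = d + x" "tau (tau x) + tau x + x = 0"
    by (rule DM_decomp)
  have "d = y - x"
    using dx(3) by simp
  then have "d \<in> M"
    using assms dx(2) M_closed by simp
  then have "d = 0"
    using D_nondeg[OF dx(1)] by (simp add: M_def pol_commute)
  then show ?thesis
    using dx(3,4) by (simp add: algebra_simps eq_neg_iff_add_eq_0)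
qed

lemma M_anisotropic_exists: "\<exists>v\<in>M. n v \<noteq> 0"
proof (rule ccontr)
  assume "\<not> ?thesis"
  then have *: "n v = 0" if "v \<in> M" for v
    using that by blast
  have M0: "y = 0" if "y \<in> M" for y
    using that by (intro M_nondeg) (simp_all add: pol_def * M_closed)
  have "e \<star> x = x \<star> e" for x
    by (metis D_iff DM_decomp M0 add.right_neutral)
  then show False
    using centre e_nonzero by blast
qed

lemma M_orth: "y \<in> M \<Longrightarrow> pol n y e = 0" "y \<in> M \<Longrightarrow> d \<in> D \<Longrightarrow> pol n d y = 0"
  using D_closed(1) by (auto simp: M_def pol_commute)

lemma M_cj: "y \<in> M \<Longrightarrow> cj y = - y"
  by (simp add: cj_orth M_orth)

definition cube_root :: "'v \<Rightarrow> bool" where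
  "cube_root w \<longleftrightarrow> w \<in> D \<and> n w = 1 \<and> pol n w e = -1"

lemma M_cube_root:
  assumes v: "v \<in> M" and nv: "n v \<noteq> 0"
  shows "\<exists>w. cube_root w \<and> tau v = w \<cdot> v"
proof -
  define w where "w = (1 / n v) \<odot> (tau v \<cdot> cj v)"
  have "n (tau (tau v)) = n (tau v + v)"
    using M_tau[OF v] n_minus[of "tau v + v"] by simp
  then have tv: "pol n (tau v) v = - n v"
    by (simp add: n_tau n_add pol_commute[of v] algebra_simps eq_neg_iff_add_eq_0)
  have 1: "tau (tau v) \<cdot> tau (cj v) = tau v \<cdot> cj v"
  proof -
    have "tau (tau v) \<cdot> tau (cj v) = - (n v \<odot> e) - v \<cdot> cj (tau v)"
      using mult_cj_self[of "tau v"] by (simp add: M_tau[OF v] m_simps tau_cj n_tau)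
    moreover have "tau v \<cdot> cj v + v \<cdot> cj (tau v) = - (n v \<odot> e)"
      using cj_lin[of "tau v" v] by (simp add: tv)
    ultimately show ?thesis
      by (metis add_diff_cancel_right')
  qed
  have "w \<in> D"
    by (simp add: D_def w_def tau_simps tau_dot 1)
  moreover have "n w = 1"
    using nv by (simp add: w_def n_scale n_mult n_tau power2_eq_square)
  moreover have "pol n w e = -1"
    using adj_right[of "tau v" "cj v" e] nv by (simp add: w_def pol_simps tv)
  moreover have "w \<cdot> v = tau v"
    using cj_cancel_mult[of "tau v" v] nv by (simp add: w_def m_simps)
  ultimately show ?thesis
    unfolding cube_root_def by metis
qed

lemma cube_root_cj: 
  assumes "cube_root w" 
  shows "cj w = - e - w" and "cube_root (cj w)"
proof -
  show "cj w = - e - w"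
    using assms by (simp add: cj_def cube_root_def)
  have "pol n (cj w) e = pol n w e"
    using pol_cj[of w e] by simp
  then show "cube_root (cj w)"
    using assms by (simp add: cube_root_def D_closed)
qed

lemma cube_root_mult:
  assumes "cube_root w"
  shows "w \<cdot> (w \<cdot> x) = - (w \<cdot> x) - x" "w \<cdot> w = - w - e"
    "w \<cdot> (cj w \<cdot> x) = x" "cj w \<cdot> (w \<cdot> x) = x" "cj w \<cdot> x = - x - w \<cdot> x"
    "cj w \<cdot> (cj w \<cdot> x) = w \<cdot> x"
proof -
  have nw: "n w = 1"
    using assms by (simp add: cube_root_def)
  show 1: "w \<cdot> (cj w \<cdot> x) = x" "cj w \<cdot> (w \<cdot> x) = x" for x
    by (simp_all add: mult_cancel_cj cj_mult_cancel nw)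
  show 2: "cj w \<cdot> x = - x - w \<cdot> x" for x
    by (simp add: cube_root_cj[OF assms] m_simps)
  show 3: "w \<cdot> (w \<cdot> x) = - (w \<cdot> x) - x" for x
    using 1(1)[of x] by (simp add: 2 m_simps algebra_simps)
  show "w \<cdot> w = - w - e"
    using 3[of e] by simp
  show "cj w \<cdot> (cj w \<cdot> x) = w \<cdot> x"
    by (simp add: 2 3 m_simps)
qed

lemma eigenspaces_orth:
  assumes w: "cube_root w" and x: "tau x = w \<cdot> x" and y: "tau y = cj w \<cdot> y"
  shows "pol n x y = 0"
proof -
  have wD: "tau w = w" "tau (cj w) = cj w"
    using w by (simp_all add: cube_root_def D_def tau_cj)
  have 1: "pol n x z = pol n x (w \<cdot> z)" if "tau z = cj w \<cdot> z" for z
    using pol_tau[of x z] by (simp add: x that adj_left cube_root_mult(6)[OF w])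
  have "pol n x (w \<cdot> y) = pol n x (w \<cdot> (w \<cdot> y))"
    by (rule 1) (simp add: tau_dot wD y cube_root_mult(3,4)[OF w])
  then have "3 * pol n x y = 0"
    using 1[OF y] by (simp add: cube_root_mult(1)[OF w] pol_simps algebra_simps)
  then show ?thesis
    using three by simp
qed

lemma eigenspaces_product:
  assumes w: "cube_root w" and x: "x \<in> M" "tau x = w \<cdot> x" and y: "y \<in> M" "tau y = cj w \<cdot> y"
  shows "x \<cdot> y \<in> D" "pol n (x \<cdot> y) e = 0" "pol n (x \<cdot> y) w = 0"
proof -
  have wD: "w \<in> D" "cj w \<in> D" "tau w = w" "tau (cj w) = cj w"
    using w by (simp_all add: cube_root_def D_closed) (simp_all add: D_def tau_cj)
  have xy: "pol n x y = 0" 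
    using eigenspaces_orth[OF w x(2) y(2)] .
  have xwy: "pol n x (w \<cdot> y) = 0"
    by (rule eigenspaces_orth[OF w x(2)]) (simp add: tau_dot wD y cube_root_mult(3,4)[OF w])
  have xwy': "pol n x (cj w \<cdot> y) = 0"
    using xy xwy by (simp add: cube_root_mult(5)[OF w] pol_simps)
  have "cj (cj w \<cdot> y) = - (cj w \<cdot> y)"
    using D_mult_M wD(2) y(1) M_cj by blast
  then have "(w \<cdot> x) \<cdot> (cj w \<cdot> y) = - (y \<cdot> x)"
    using cj_lin_right[of w x "cj w \<cdot> y"]
    by (simp add: M_cj x(1) m_simps xwy' cube_root_mult(3)[OF w] minus_equation_iff[of _ "y \<cdot> x"])
  moreover have "x \<cdot> y = - (y \<cdot> x)"
  proof -
    have "- (x \<cdot> y) = y \<cdot> x"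
      using cj_lin[of x y] by (simp add: M_cj x(1) y(1) m_simps xy)
    then show ?thesis
      by (metis minus_minus)
  qed
  ultimately show "x \<cdot> y \<in> D"
    unfolding D_def mem_Collect_eq tau_dot x(2) y(2) by simp
  show "pol n (x \<cdot> y) e = 0" "pol n (x \<cdot> y) w = 0"
    by (simp_all add: adj_right M_cj y(1) m_simps pol_simps xy xwy)
qed

lemma isotropic_eigenspace:
  assumes w: "cube_root w" 
    and iso: "\<And>x. x \<in> M \<Longrightarrow> tau x = w \<cdot> x \<Longrightarrow> n x = 0" and y: "y \<in> M"
  shows "tau y = cj w \<cdot> y"
proof -
  have wD: "w \<in> D" "cj w \<in> D" "tau w = w" "tau (cj w) = cj w"
    using w by (simp_all add: cube_root_def D_closed) (simp_all add: D_def tau_cj)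
  have proj1: "tau z - cj w \<cdot> z \<in> M \<and> tau (tau z - cj w \<cdot> z) = w \<cdot> (tau z - cj w \<cdot> z)"
    if "z \<in> M" for z
    using that M_closed tau_M D_mult_M wD
    by (simp add: M_tau tau_simps tau_dot) (simp add: cube_root_mult(1,5)[OF w] m_simps)
  have proj2: "tau z - w \<cdot> z \<in> M \<and> tau (tau z - w \<cdot> z) = cj w \<cdot> (tau z - w \<cdot> z)"
    if "z \<in> M" for z
    using that M_closed tau_M D_mult_M wD
    by (simp add: M_tau tau_simps tau_dot) (simp add: cube_root_mult(1,5)[OF w] m_simps)
  define x where "x = tau y - cj w \<cdot> y"
  have x: "x \<in> M" "tau x = w \<cdot> x"
    using proj1[OF y] by (auto simp: x_def)
  have 1: "pol n x z = 0" if z: "z \<in> M" "tau z = w \<cdot> z" for z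
    unfolding pol_def using iso x z by (simp only: M_closed tau_add m_add_right iso) simp
  have 2: "pol n x (w \<cdot> z) - pol n x (cj w \<cdot> z) = 0" if z: "z \<in> M" for z
  proof -
    have "pol n x (tau z - cj w \<cdot> z) = 0" "pol n x (tau z - w \<cdot> z) = 0"
      using 1 proj1[OF z] eigenspaces_orth[OF w x(2)] proj2[OF z] by blast+
    then show ?thesis
      by (simp add: pol_diff_right)
  qed
  have "pol n x z = 0" if z: "z \<in> M" for z
  proof -
    have "pol n x (w \<cdot> (w \<cdot> z - cj w \<cdot> z)) - pol n x (cj w \<cdot> (w \<cdot> z - cj w \<cdot> z)) = 0"
      using z by (intro 2) (simp add: M_closed D_mult_M wD)
    then have "3 * pol n x z = 0"
      by (simp only: m_diff_right cube_root_mult[OF w]) (simp add: m_simps pol_simps algebra_simps)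
    then show ?thesis
      using three by simp
  qed
  then have "x = 0"
    by (intro M_nondeg x)
  then show ?thesis by (simp add: x_def)
qed

lemma not_scalar_action:
  assumes w: "cube_root w" and DK: "\<And>d. d \<in> D \<Longrightarrow> \<exists>a b. d = a \<odot> e + b \<odot> w"
    and M: "\<And>y. y \<in> M \<Longrightarrow> tau y = w \<cdot> y"
  shows False
proof -
  have wD: "w \<in> D" "cj w \<in> D" "tau w = w" "tau (cj w) = cj w"
    using w by (simp_all add: cube_root_def D_closed) (simp_all add: D_def tau_cj)
  have "cj w \<star> x = x \<star> cj w" for x
  proof -
    obtain d y where x: "d \<in> D" "y \<in> M" "x = d + y"
      by (rule DM_decomp)
    obtain a b where d: "d = a \<odot> e + b \<odot> w"
      using DK x(1) by blast
    have "cj w \<star> d = d \<star> cj w"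
      using wD by (simp add: d star_eq star.m_simps cj_add cj_scale tau_simps m_simps)
         (simp add: cube_root_cj[OF w] m_simps)
    moreover have "cj w \<star> y = y \<star> cj w"
    proof -
      have wy: "w \<cdot> y \<in> M"
        using D_mult_M wD(1) x(2) by blast
      have "(w \<cdot> y) \<cdot> w = cj w \<cdot> (w \<cdot> y)"
        using cj_lin[of "cj w" "w \<cdot> y"] M_orth(2)[OF wy wD(2)]
        by (simp add: M_cj wy m_simps)
      then show ?thesis
        using x(2) wy by (simp add: star_eq wD M_cj tau_minus M m_simps cube_root_mult[OF w])
    qed
    ultimately show ?thesis
      by (simp add: x(3) star.m_simps)
  qed
  then have "cj w = 0"
    by (rule centre)
  moreover have "n (cj w) = 1"
    using w by (simp add: cube_root_def)
  ultimately show False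
    by simp
qed

lemma quaternion_complement_exists:
  assumes w: "cube_root w"
  shows "\<exists>u\<in>D. pol n u e = 0 \<and> pol n u w = 0 \<and> n u \<noteq> 0"
proof (rule ccontr)
  assume "\<not> ?thesis"
  then have iso: "n u = 0" if "u \<in> D" "pol n u e = 0" "pol n u w = 0" for u
    using that by blast
  have wD: "w \<in> D" "n w = 1" "pol n w e = -1"
    using w by (simp_all add: cube_root_def)
  have nine: "(9::'f) \<noteq> 0"
    using three mult_eq_0_iff[of "3::'f" 3] by simp
  define P where "P d = d - ((2 * pol n d e + pol n d w) / 3) \<odot> e - ((pol n d e + 2 * pol n d w) / 3) \<odot> w" for d
  have P: "P d \<in> D" "pol n (P d) e = 0" "pol n (P d) w = 0" if "d \<in> D" for d
    using that three nine wD by (simp_all add: P_def D_closed pol_simps pol_self pol_commute[of e w] field_simps)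
  have K0: "u = 0" if u: "u \<in> D" "pol n u e = 0" "pol n u w = 0" for u
  proof (rule D_nondeg[OF u(1)])
    fix d assume d: "d \<in> D"
    have "pol n u (P d) = 0"
      using iso u P[OF d] by (simp add: pol_def[of n u "P d"] D_closed pol_simps)
    then show "pol n u d = 0"
      by (simp add: P_def pol_simps u)
  qed
  have DK: "\<exists>a b. d = a \<odot> e + b \<odot> w" if "d \<in> D" for d
  proof -
    have "P d = 0"
      using K0 P that by blast
    then have "d = ((2 * pol n d e + pol n d w) / 3) \<odot> e + ((pol n d e + 2 * pol n d w) / 3) \<odot> w"
      by (simp only: P_def diff_diff_eq right_minus_eq)
    then show ?thesis by blast
  qed
  have "n x = 0 \<or> n y = 0" if "x \<in> M" "tau x = w \<cdot> x" "y \<in> M" "tau y = cj w \<cdot> y" for x y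
    using iso[OF eigenspaces_product[OF w that]] by (simp add: n_mult)
  then consider "\<And>x. x \<in> M \<Longrightarrow> tau x = w \<cdot> x \<Longrightarrow> n x = 0" 
    | "\<And>x. x \<in> M \<Longrightarrow> tau x = cj w \<cdot> x \<Longrightarrow> n x = 0"
    by blast
  then show False
  proof cases
    case 1
    have "\<exists>a b. d = a \<odot> e + b \<odot> cj w" if d: "d \<in> D" for d
    proof -
      obtain a b where "cj d = a \<odot> e + b \<odot> w"
        using DK D_closed(3)[OF d] by blast
      then have "d = a \<odot> e + b \<odot> cj w"
        by (metis cj_add cj_cj cj_e cj_scale)
      then show ?thesis by blast
    qed
    then show False
      using not_scalar_action[OF cube_root_cj(2)[OF w]] isotropic_eigenspace[OF w 1] by blast
  next
    case 2
    then have "tau y = w \<cdot> y" if "y \<in> M" for y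
      using isotropic_eigenspace[OF cube_root_cj(2)[OF w], of y] that by simp
    then show False
      using not_scalar_action[OF w DK] by blast
  qed
qed

end

section \<open>The model built by doubling\<close>

definition dbl_mul :: "'f \<Rightarrow> ('f \<Rightarrow> 'p \<Rightarrow> 'p) \<Rightarrow> ('p \<Rightarrow> 'p \<Rightarrow> 'p) \<Rightarrow> ('p \<Rightarrow> 'p)
    \<Rightarrow> 'p \<times> 'p \<Rightarrow> 'p \<times> 'p \<Rightarrow> ('p::ab_group_add) \<times> 'p" where
  "dbl_mul c s m j x y =
     (m (fst x) (fst y) - s c (m (j (snd y)) (snd x)), m (snd y) (fst x) + m (snd x) (j (fst y)))"

definition dbl_cj :: "('p \<Rightarrow> 'p) \<Rightarrow> 'p \<times> 'p \<Rightarrow> ('p::ab_group_add) \<times> 'p" where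
  "dbl_cj j x = (j (fst x), - snd x)"

type_synonym 'f quad = "'f \<times> 'f"
type_synonym 'f quat = "'f quad \<times> 'f quad"
type_synonym 'f oct = "'f quat \<times> 'f quat"

text \<open>The pair \<open>(a, b)\<close> stands for \<open>a + b w\<close> with \<open>w\<^sup>2 + w + 1 = 0\<close>.\<close>

definition k_scl :: "'f::field \<Rightarrow> 'f quad \<Rightarrow> 'f quad" where
  "k_scl = dbl_scl (*)"

definition k_mul :: "'f::field quad \<Rightarrow> 'f quad \<Rightarrow> 'f quad" where
  "k_mul x y = (fst x * fst y - snd x * snd y, fst x * snd y + snd x * fst y - snd x * snd y)"

definition k_cj :: "'f::field quad \<Rightarrow> 'f quad" where
  "k_cj x = (fst x - snd x, - snd x)"

definition k_nrm :: "'f::field quad \<Rightarrow> 'f" where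
  "k_nrm x = (fst x)\<^sup>2 - fst x * snd x + (snd x)\<^sup>2"

definition h_scl :: "'f::field \<Rightarrow> 'f quat \<Rightarrow> 'f quat" where
  "h_scl = dbl_scl k_scl"

definition h_mul :: "'f::field \<Rightarrow> 'f quat \<Rightarrow> 'f quat \<Rightarrow> 'f quat" where
  "h_mul a = dbl_mul a k_scl k_mul k_cj"

definition h_cj :: "'f::field quat \<Rightarrow> 'f quat" where
  "h_cj = dbl_cj k_cj"

definition h_nrm :: "'f::field \<Rightarrow> 'f quat \<Rightarrow> 'f" where
  "h_nrm a = dbl_nrm a k_nrm"

definition o_scl :: "'f::field \<Rightarrow> 'f oct \<Rightarrow> 'f oct" where
  "o_scl = dbl_scl h_scl"

definition o_mul :: "'f::field \<Rightarrow> 'f \<Rightarrow> 'f oct \<Rightarrow> 'f oct \<Rightarrow> 'f oct" where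
  "o_mul a b = dbl_mul b h_scl (h_mul a) h_cj"

definition o_cj :: "'f::field oct \<Rightarrow> 'f oct" where
  "o_cj = dbl_cj h_cj"

definition o_nrm :: "'f::field \<Rightarrow> 'f \<Rightarrow> 'f oct \<Rightarrow> 'f" where
  "o_nrm a b = dbl_nrm b (h_nrm a)"

definition h_w :: "'f::field quat" where
  "h_w = ((0, 1), 0)"

definition o_one :: "'f::field oct" where
  "o_one = (((1, 0), 0), 0)"

definition o_tau :: "'f::field \<Rightarrow> 'f oct \<Rightarrow> 'f oct" where
  "o_tau a x = (fst x, h_mul a h_w (snd x))"

definition o_star :: "'f::field \<Rightarrow> 'f \<Rightarrow> 'f oct \<Rightarrow> 'f oct \<Rightarrow> 'f oct" where
  "o_star a b x y = o_mul a b (o_tau a (o_cj x)) (o_tau a (o_tau a (o_cj y)))"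

definition model :: "'f::field \<Rightarrow> 'f \<Rightarrow> ('f, 'f oct) qalg" where
  "model a b = \<lparr>vecs = UNIV, scl = o_scl, mul = o_star a b, nrm = o_nrm a b\<rparr>"

lemma model_simps [simp]:
  "vecs (model a b) = UNIV" "scl (model a b) = o_scl" "mul (model a b) = o_star a b"
  "nrm (model a b) = o_nrm a b"
  by (simp_all add: model_def)

lemma quad_space_k: "quad_space k_scl (k_nrm :: 'f::field quad \<Rightarrow> 'f)"
  by unfold_locales
    (simp_all add: k_scl_def dbl_scl_def k_nrm_def pol_def power2_eq_square algebra_simps)

lemma quad_space_h: "quad_space h_scl (h_nrm a)"
  unfolding h_scl_def h_nrm_def by (intro quad_space.quad_space_dbl quad_space_k)

lemma nondegenerate_k:
  assumes "(3::'f::field) \<noteq> 0"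
  shows "nondegenerate (k_nrm :: 'f quad \<Rightarrow> 'f)"
  unfolding nondegenerate_def
proof (intro allI impI)
  fix x :: "'f quad"
  assume *: "\<forall>y. pol k_nrm x y = 0"
  obtain a b where x: "x = (a, b)" by fastforce
  have 1: "2 * a - b = 0" "2 * b - a = 0"
    using *[rule_format, of "(1, 0)"] *[rule_format, of "(0, 1)"]
    by (simp_all add: x pol_def k_nrm_def power2_eq_square algebra_simps)
  have "3 * a = 0" "3 * b = 0"
    using 1 by algebra+
  then show "x = 0"
    using assms by (simp add: x zero_prod_def)
qed

lemma nondegenerate_h: "(3::'f::field) \<noteq> 0 \<Longrightarrow> a \<noteq> 0 \<Longrightarrow> nondegenerate (h_nrm (a::'f))"
  unfolding h_nrm_def by (intro quad_space.nondegenerate_dbl[OF quad_space_k] nondegenerate_k)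

lemma nondegenerate_o:
  "(3::'f::field) \<noteq> 0 \<Longrightarrow> a \<noteq> 0 \<Longrightarrow> b \<noteq> 0 \<Longrightarrow> nondegenerate (o_nrm (a::'f) b)"
  unfolding o_nrm_def by (intro quad_space.nondegenerate_dbl[OF quad_space_h] nondegenerate_h)

lemmas h_defs = h_scl_def h_mul_def h_cj_def h_nrm_def
  dbl_scl_def dbl_mul_def dbl_cj_def dbl_nrm_def k_scl_def k_mul_def k_cj_def k_nrm_def

lemma k_nrm_mult: "k_nrm (k_mul x y) = k_nrm x * k_nrm y"
  by (simp add: k_nrm_def k_mul_def power2_eq_square algebra_simps)

lemma h_nrm_mult: "h_nrm a (h_mul a x y) = h_nrm a x * h_nrm a y"
proof -
  obtain x1 x2 x3 x4 y1 y2 y3 y4 where "x = ((x1, x2), (x3, x4))" "y = ((y1, y2), (y3, y4))"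
    by (metis surj_pair)
  then show ?thesis
    by (simp add: h_defs power2_eq_square algebra_simps)
qed

lemma mult_form_k:
  assumes "(3::'f::field) \<noteq> 0"
  shows "mult_form k_scl (k_nrm :: 'f quad \<Rightarrow> 'f) [(1, 0), (0, 1)] (1, 0)"
proof -
  interpret quad_space k_scl "k_nrm :: 'f quad \<Rightarrow> 'f"
    by (rule quad_space_k)
  show ?thesis
  proof
    show "nondegenerate (k_nrm :: 'f quad \<Rightarrow> 'f)"
      by (rule nondegenerate_k[OF assms])
    show "\<exists>z. k_nrm z = k_nrm x * k_nrm y" for x y :: "'f quad"
      using k_nrm_mult by blast
    show "k_nrm (1, 0::'f) = 1"
      by (simp add: k_nrm_def)
    fix x :: "'f quad"
    assume *: "\<And>i. i < length [(1, 0), (0, 1::'f)] \<Longrightarrow> pol k_nrm x ([(1, 0), (0, 1)] ! i) = 0"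
    have "pol k_nrm x y = 0" for y
    proof -
      have y: "y = k_scl (fst y) (1, 0) + k_scl (snd y) (0, 1)"
        by (simp add: k_scl_def dbl_scl_def)
      show ?thesis
        using *[of 0] *[of 1] by (subst y) (simp add: pol_add_right pol_scale_right)
    qed
    then show "x = 0"
      using nondegenerate_k[OF assms] unfolding nondegenerate_def by blast
  qed
qed

lemma mult_form_h:
  assumes "(3::'f::field) \<noteq> 0" "a \<noteq> 0"
  shows "mult_form h_scl (h_nrm (a::'f))
    [((1, 0), 0), ((0, 1), 0), (0, (1, 0)), (0, (0, 1))] ((1, 0), 0)" (is "mult_form _ _ ?bs _")
proof -
  interpret quad_space h_scl "h_nrm a"
    by (rule quad_space_h)
  show ?thesis
  proof
    show "nondegenerate (h_nrm a)"
      by (rule nondegenerate_h[OF assms])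
    show "\<exists>z. h_nrm a z = h_nrm a x * h_nrm a y" for x y
      using h_nrm_mult by blast
    show "h_nrm a ((1, 0), 0) = 1"
      by (simp add: h_defs)
    fix x 
    assume *: "\<And>i. i < length ?bs \<Longrightarrow> pol (h_nrm a) x (?bs ! i) = 0"
    have "pol (h_nrm a) x y = 0" for y
    proof -
      have y: "y = h_scl (fst (fst y)) ((1, 0), 0) + h_scl (snd (fst y)) ((0, 1), 0)
          + h_scl (fst (snd y)) (0, (1, 0)) + h_scl (snd (snd y)) (0, (0, 1))"
        by (cases y) (auto simp: h_scl_def k_scl_def dbl_scl_def zero_prod_def)
      show ?thesis
        using *[of 0] *[of 1] *[of 2] *[of 3]
        by (subst y) (simp add: pol_add_right pol_scale_right numeral_2_eq_2 numeral_3_eq_3)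
    qed
    then show "x = 0"
      using nondegenerate_h[OF assms] unfolding nondegenerate_def by blast
  qed
qed

lemma centralizer_model:
  assumes "(3::'f::field) \<noteq> 0"
  shows "x \<in> centralizer (model a b) o_one \<longleftrightarrow> snd (x :: 'f oct) = 0"
proof -
  obtain x1 x2 x3 x4 x5 x6 x7 x8 where x: "x = (((x1, x2), (x3, x4)), ((x5, x6), (x7, x8)))"
    by (metis surj_pair)
  have *: "s = 2 * t \<and> 2 * s = t \<longleftrightarrow> s = 0 \<and> t = 0" for s t :: 'f
  proof
    assume "s = 2 * t \<and> 2 * s = t"
    then have "3 * s = 0" "3 * t = 0"
      by algebra+
    then show "s = 0 \<and> t = 0"
      using assms by simp
  qed simp
  show ?thesis
    using *[of x5 x6] *[of x7 x8]
    by (simp add: x centralizer_def o_star_def o_mul_def o_tau_def o_cj_def h_w_def o_one_def h_defs zero_prod_def)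
      blast
qed

context hurwitz
begin

definition hom :: "('f \<Rightarrow> 'p::ab_group_add \<Rightarrow> 'p) \<Rightarrow> ('p \<Rightarrow> 'p \<Rightarrow> 'p) \<Rightarrow> ('p \<Rightarrow> 'p) \<Rightarrow> ('p \<Rightarrow> 'v) \<Rightarrow> bool" where
  "hom s mm j \<phi> \<longleftrightarrow> (\<forall>x y. \<phi> (x + y) = \<phi> x + \<phi> y) \<and> (\<forall>a x. \<phi> (s a x) = a \<odot> \<phi> x) \<and>
     (\<forall>x y. \<phi> (mm x y) = \<phi> x \<cdot> \<phi> y) \<and> (\<forall>x. \<phi> (j x) = cj (\<phi> x)) \<and> e \<in> range \<phi>"

lemma hom_dbl:
  assumes hom: "hom s mm j \<phi>" and orth: "\<And>x. pol n (\<phi> x) v = 0"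
  defines "\<psi> \<equiv> \<lambda>x. \<phi> (fst x) + \<phi> (snd x) \<cdot> v"
  shows "hom (dbl_scl s) (dbl_mul (n v) s mm j) (dbl_cj j) \<psi>"
    and "n (\<psi> x) = dbl_nrm (n v) (\<lambda>x. n (\<phi> x)) x"
proof -
  have add: "\<phi> (x + y) = \<phi> x + \<phi> y" and scl: "\<phi> (s a x) = a \<odot> \<phi> x"
    and mult: "\<phi> (mm x y) = \<phi> x \<cdot> \<phi> y" and cj: "\<phi> (j x) = cj (\<phi> x)" and e: "e \<in> range \<phi>" for x y a
    using hom by (auto simp: hom_def)
  have zero: "\<phi> 0 = 0"
    using add[of 0 0] by simp
  have minus: "\<phi> (- x) = - \<phi> x" for x
    using add[of x "- x"] by (simp add: zero minus_unique)
  have diff: "\<phi> (x - y) = \<phi> x - \<phi> y" for x y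
    using add[of x "- y"] by (simp add: minus)
  have D: "\<And>x y. x \<in> range \<phi> \<Longrightarrow> y \<in> range \<phi> \<Longrightarrow> x \<cdot> y \<in> range \<phi>"
    "\<And>x. x \<in> range \<phi> \<Longrightarrow> cj x \<in> range \<phi>" "\<And>x. x \<in> range \<phi> \<Longrightarrow> pol n x v = 0"
    using orth by (auto simp flip: mult cj)
  note dm = dbl_mult[OF e D] and dn = n_dbl[OF e D] and dc = cj_dbl_add[OF e D]
  show "n (\<psi> x) = dbl_nrm (n v) (\<lambda>x. n (\<phi> x)) x"
    by (simp add: \<psi>_def dbl_nrm_def dn)
  have "e \<in> range \<psi>"
  proof -
    obtain x where "e = \<phi> x" using e by auto
    then have "e = \<psi> (x, 0)"
      by (simp add: \<psi>_def zero)
    then show ?thesis by blast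
  qed
  moreover have "\<psi> (dbl_mul (n v) s mm j x y) = \<psi> x \<cdot> \<psi> y" for x y
    by (simp add: \<psi>_def dbl_mul_def dm add diff scl mult cj)
  moreover have "\<psi> (dbl_cj j x) = cj (\<psi> x)" for x
    by (simp add: \<psi>_def dbl_cj_def dc cj minus m_minus_left)
  moreover have "\<psi> (x + y) = \<psi> x + \<psi> y" "\<psi> (dbl_scl s a x) = a \<odot> \<psi> x" for x y a
    by (simp_all add: \<psi>_def dbl_scl_def add scl m_simps scale_right_distrib)
  ultimately show "hom (dbl_scl s) (dbl_mul (n v) s mm j) (dbl_cj j) \<psi>"
    by (simp add: hom_def del: split_paired_All)
qed

end

definition total_alg :: "('f::field \<Rightarrow> 'v::ab_group_add \<Rightarrow> 'v) \<Rightarrow> ('v \<Rightarrow> 'v \<Rightarrow> 'v) \<Rightarrow> ('v \<Rightarrow> 'f) \<Rightarrow> ('f, 'v) qalg" where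
  "total_alg s m n = \<lparr>vecs = UNIV, scl = s, mul = m, nrm = n\<rparr>"

lemma total_alg_simps [simp]:
  "vecs (total_alg s m n) = UNIV" "scl (total_alg s m n) = s" "mul (total_alg s m n) = m"
  "nrm (total_alg s m n) = n"
  by (simp_all add: total_alg_def)

locale okubo_idem8 = okubo_idem +
  assumes dim8: "\<And>g :: 'a oct \<Rightarrow> 'b. (\<And>x y. g (x + y) = g x + g y) \<Longrightarrow>
    (\<And>a x. g (o_scl a x) = sc a (g x)) \<Longrightarrow> inj g \<Longrightarrow> surj g"
begin

lemma model_iso_exists:
  assumes v: "v \<in> M" "n v \<noteq> 0" and w: "cube_root w" "tau v = w \<cdot> v"
    and u: "u \<in> D" "pol n u e = 0" "pol n u w = 0" "n u \<noteq> 0"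
  shows "\<exists>\<psi>. is_iso (model (n u) (n v)) (total_alg sc st n) \<psi> \<and> \<psi> o_one = e"
proof -
  define \<phi>K where "\<phi>K x = sc (fst x) e + sc (snd x) w" for x
  define \<phi>H where "\<phi>H x = \<phi>K (fst x) + \<phi>K (snd x) \<cdot> u" for x
  define \<phi> where "\<phi> x = \<phi>H (fst x) + \<phi>H (snd x) \<cdot> v" for x
  have w': "w \<in> D" "n w = 1" "pol n w e = -1"
    using w(1) by (simp_all add: cube_root_def)
  have homK: "hom k_scl k_mul k_cj \<phi>K"
  proof -
    have "e = \<phi>K (1, 0)"
      by (simp add: \<phi>K_def)
    then have "e \<in> range \<phi>K" by blast
    then show ?thesis
      unfolding hom_def
      by (simp add: \<phi>K_def k_scl_def k_mul_def k_cj_def dbl_scl_def scale_left_distrib scale_right_distrib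
        scale_left_diff_distrib scale_right_diff_distrib m_simps cube_root_mult(2)[OF w(1)] cube_root_cj[OF w(1)]
        cj_add cj_scale algebra_simps)
  qed
  have nK: "n (\<phi>K x) = k_nrm x" for x
    by (simp add: \<phi>K_def k_nrm_def n_add n_scale w' pol_simps pol_commute[of e w])
  have KD: "\<phi>K x \<in> D" for x
    by (simp add: \<phi>K_def D_closed w')
  have "pol n (\<phi>K x) u = 0" for x
    using u by (simp add: \<phi>K_def pol_simps pol_commute[of _ u])
  note H = hom_dbl[OF homK this]
  have homH: "hom h_scl (h_mul (n u)) h_cj \<phi>H"
    using H(1) by (simp add: h_scl_def h_mul_def h_cj_def \<phi>H_def[abs_def])
  have nH: "n (\<phi>H x) = h_nrm (n u) x" for x
    using H(2) by (simp add: \<phi>H_def h_nrm_def nK)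
  have HD: "\<phi>H x \<in> D" for x
    by (simp add: \<phi>H_def D_closed KD u)
  have Hv: "pol n (\<phi>H x) v = 0" for x
    using HD v by (simp add: M_def)
  note O = hom_dbl[OF homH Hv]
  have homO: "hom o_scl (o_mul (n u) (n v)) o_cj \<phi>"
    using O(1) by (simp add: o_scl_def o_mul_def o_cj_def \<phi>_def[abs_def])
  have nO: "n (\<phi> x) = o_nrm (n u) (n v) x" for x
    using O(2) by (simp add: \<phi>_def o_nrm_def nH)
  have add: "\<phi> (x + y) = \<phi> x + \<phi> y" and scl: "\<phi> (o_scl a x) = sc a (\<phi> x)"
    and mult: "\<phi> (o_mul (n u) (n v) x y) = \<phi> x \<cdot> \<phi> y" and cj: "\<phi> (o_cj x) = cj (\<phi> x)" for x y a
    using homO by (simp_all add: hom_def del: split_paired_All)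
  have tau: "\<phi> (o_tau (n u) x) = tau (\<phi> x)" for x
  proof -
    have hw: "\<phi>H h_w = w"
      by (simp add: \<phi>H_def \<phi>K_def h_w_def)
    have "\<phi>H (h_mul (n u) h_w y) = w \<cdot> \<phi>H y" for y
      using homH hw by (simp add: hom_def del: split_paired_All)
    moreover have "tau (\<phi>H y) = \<phi>H y" for y
      using HD by (simp add: D_def)
    moreover have "(w \<cdot> \<phi>H y) \<cdot> v = \<phi>H y \<cdot> (w \<cdot> v)" for y
      using dbl_left[of D v "\<phi>H y" w] D_closed v HD w' by (simp add: M_def)
    ultimately show ?thesis
      by (simp add: \<phi>_def o_tau_def tau_simps tau_dot w)
  qed
  have star: "\<phi> (o_star (n u) (n v) x y) = st (\<phi> x) (\<phi> y)" for x y
    by (simp add: o_star_def mult tau cj star_eq)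
  have "inj \<phi>"
  proof (rule injI)
    fix x y assume xy: "\<phi> x = \<phi> y"
    have "\<phi> (x - y) + \<phi> y = \<phi> x"
      by (simp flip: add)
    then have 0: "\<phi> (x - y) = 0"
      using xy by simp
    have "pol (o_nrm (n u) (n v)) (x - y) z = 0" for z
      by (simp add: pol_def add 0 flip: nO)
    then show "x = y"
      using nondegenerate_o[OF three u(4) v(2)] by (metis nondegenerate_def right_minus_eq)
  qed
  then have "bij \<phi>"
    using dim8 add scl by (simp add: bij_def)
  moreover have "\<phi> o_one = e"
    by (simp add: \<phi>_def \<phi>H_def \<phi>K_def o_one_def)
  ultimately show ?thesis
    by (intro exI[of _ \<phi>]) (simp add: is_iso_def add scl star nO del: split_paired_All)
qed

lemma idem_model: "\<exists>a b \<psi>. a \<noteq> 0 \<and> b \<noteq> 0 \<and> is_iso (model a b) (total_alg sc st n) \<psi> \<and> \<psi> o_one = e"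
  using M_anisotropic_exists M_cube_root quaternion_complement_exists model_iso_exists by metis

lemma idem_model_change:
  assumes iso: "is_iso (model a b) (total_alg sc st n) \<psi>" "\<psi> o_one = e" and d: "h_nrm a d \<noteq> 0" and b: "b \<noteq> 0"
  shows "\<exists>a' \<psi>. a' \<noteq> 0 \<and> is_iso (model a' (b * h_nrm a d)) (total_alg sc st n) \<psi> \<and> \<psi> o_one = e"
proof -
  define v where "v = \<psi> (0, d)"
  interpret H: quad_space h_scl "h_nrm a"
    by (rule quad_space_h)
  have bij: "bij \<psi>" and add: "\<psi> (x + y) = \<psi> x + \<psi> y" and star: "\<psi> (o_star a b x y) = st (\<psi> x) (\<psi> y)" 
    and nrm: "n (\<psi> x) = o_nrm a b x" for x y
    using iso(1) by (simp_all add: is_iso_def del: split_paired_All)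
  have nv: "n v = b * h_nrm a d"
    by (simp add: v_def nrm o_nrm_def dbl_nrm_def)
  have "v \<in> M"
    unfolding M_def
  proof (intro CollectI ballI)
    fix z assume z: "z \<in> D"
    obtain x where x: "z = \<psi> x"
      using bij by (metis bij_pointE)
    have "\<psi> (o_star a b o_one x) = \<psi> (o_star a b x o_one)"
      using z by (simp add: D_iff star x iso(2))
    then have "x \<in> centralizer (model a b) o_one"
      using bij by (simp add: centralizer_def bij_is_inj inj_eq)
    then have "snd x = 0"
      using centralizer_model three by blast
    then show "pol n z v = 0"
      by (simp add: v_def x pol_def nrm flip: add) (simp add: o_nrm_def dbl_nrm_def)
  qed
  then show ?thesis
    using M_cube_root quaternion_complement_exists model_iso_exists nv b d
    by (metis mult_eq_0_iff)
qed

end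

lemma model_rescale:
  assumes k: "k_nrm k \<noteq> 0"
  shows "\<exists>\<psi>. is_iso (model (a * k_nrm k) b) (model a b) \<psi> \<and> \<psi> o_one = o_one"
proof -
  define \<sigma> where "\<sigma> x = (fst x, k_mul k (snd x))" for x :: "'a quat"
  define \<sigma>' where "\<sigma>' x = (fst x, k_mul (k_scl (1 / k_nrm k) (k_cj k)) (snd x))" for x :: "'a quat"
  define \<psi> where "\<psi> x = (\<sigma> (fst x), \<sigma> (snd x))" for x :: "'a oct"
  have add: "\<sigma> (x + y) = \<sigma> x + \<sigma> y" for x y
    by (simp add: \<sigma>_def k_mul_def algebra_simps)
  have diff: "\<sigma> (x - y) = \<sigma> x - \<sigma> y" for x y
    by (simp add: \<sigma>_def k_mul_def algebra_simps)
  have minus: "\<sigma> (- x) = - \<sigma> x" for x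
    by (simp add: \<sigma>_def k_mul_def algebra_simps)
  have scl: "\<sigma> (h_scl c x) = h_scl c (\<sigma> x)" for c x
    by (simp add: \<sigma>_def h_defs algebra_simps)
  have cj: "\<sigma> (h_cj x) = h_cj (\<sigma> x)" for x
    by (simp add: \<sigma>_def h_defs algebra_simps)
  have mult: "\<sigma> (h_mul (a * k_nrm k) x y) = h_mul a (\<sigma> x) (\<sigma> y)" for x y
  proof -
    obtain x1 x2 x3 x4 y1 y2 y3 y4 k1 k2 where
      "x = ((x1, x2), (x3, x4))" "y = ((y1, y2), (y3, y4))" "k = (k1, k2)"
      by (metis surj_pair)
    then show ?thesis
      by (simp add: \<sigma>_def h_defs power2_eq_square algebra_simps)
  qed
  have nrm: "h_nrm a (\<sigma> x) = h_nrm (a * k_nrm k) x" for x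
    by (simp add: \<sigma>_def h_nrm_def dbl_nrm_def k_nrm_mult)
  have w: "\<sigma> h_w = h_w"
    by (simp add: \<sigma>_def h_w_def k_mul_def zero_prod_def)
  have inv1: "k_mul (k_scl (1 / k_nrm k) (k_cj k)) (k_mul k z) = z" for z
  proof -
    have "k_mul (k_cj k) (k_mul k z) = k_scl (k_nrm k) z"
      by (simp add: h_defs power2_eq_square algebra_simps)
    moreover have "k_mul (k_scl c x) y = k_scl c (k_mul x y)" for c and x y :: "'a quad"
      by (simp add: h_defs algebra_simps)
    moreover have "k_scl (1 / k_nrm k) (k_scl (k_nrm k) z) = z"
      using k by (simp add: k_scl_def dbl_scl_def)
    ultimately show ?thesis
      by simp
  qed
  have comm: "k_mul x (k_mul y z) = k_mul y (k_mul x z)" for x y z :: "'a quad"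
    by (simp add: k_mul_def algebra_simps)
  have inv2: "k_mul k (k_mul (k_scl (1 / k_nrm k) (k_cj k)) z) = z" for z
    using inv1[of z] by (simp add: comm)
  have "\<sigma>' (\<sigma> x) = x" "\<sigma> (\<sigma>' x) = x" for x
    by (simp_all add: \<sigma>_def \<sigma>'_def inv1 inv2)
  then have "bij \<psi>"
    by (intro o_bij[of "\<lambda>x. (\<sigma>' (fst x), \<sigma>' (snd x))"]) (auto simp: \<psi>_def)
  moreover have "\<psi> (o_mul (a * k_nrm k) b x y) = o_mul a b (\<psi> x) (\<psi> y)" for x y
    by (simp add: \<psi>_def o_mul_def dbl_mul_def diff add mult scl cj)
  moreover have "\<psi> (o_tau (a * k_nrm k) x) = o_tau a (\<psi> x)" for x
    by (simp add: \<psi>_def o_tau_def mult w)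
  moreover have "\<psi> (o_cj x) = o_cj (\<psi> x)" for x
    by (simp add: \<psi>_def o_cj_def dbl_cj_def cj minus)
  moreover have "o_nrm a b (\<psi> x) = o_nrm (a * k_nrm k) b x" for x
    by (simp add: \<psi>_def o_nrm_def dbl_nrm_def nrm)
  moreover have "\<psi> (x + y) = \<psi> x + \<psi> y" "\<psi> (o_scl c x) = o_scl c (\<psi> x)" for x y c
    by (simp_all add: \<psi>_def add o_scl_def dbl_scl_def scl)
  moreover have "\<psi> o_one = o_one"
    by (simp add: \<psi>_def \<sigma>_def o_one_def k_mul_def zero_prod_def)
  ultimately show ?thesis
    by (intro exI[of _ \<psi>]) (simp add: is_iso_def o_star_def del: split_paired_All)
qed

section \<open>Coordinates of the split Okubo algebra\<close>

lemma three_arith: "(3::3) = 0" "(1::3) + 1 = 2" "(2::3) + 1 = 0" "(1::3) + 2 = 0" "(2::3) + 2 = 1"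
  "(0::3) \<noteq> 1" "(0::3) \<noteq> 2" "(1::3) \<noteq> 2" "(2::3) \<noteq> 1" "(2::3) \<noteq> 0" "(1::3) \<noteq> 0"
  by auto

lemma UNIV_3': "(UNIV :: 3 set) = {0, 1, 2}"
  using UNIV_3 three_arith(1) by auto

lemma UNIV_ix: "UNIV = {Be1, Be2, Bu 0, Bu 1, Bu 2, Bv 0, Bv 1, Bv 2}"
  by (auto simp: UNIV_cayley_ix UNIV_3')

lemma sum_ix: "(\<Sum>i\<in>UNIV. f i) = f Be1 + f Be2 + f (Bu 0) + f (Bu 1) + f (Bu 2) + f (Bv 0) + f (Bv 1) + f (Bv 2)"
  by (simp add: UNIV_ix add.assoc)

lemma vec_ix_eq: "x = y \<longleftrightarrow> x $ Be1 = y $ Be1 \<and> x $ Be2 = y $ Be2 \<and> x $ Bu 0 = y $ Bu 0 \<and>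
   x $ Bu 1 = y $ Bu 1 \<and> x $ Bu 2 = y $ Bu 2 \<and> x $ Bv 0 = y $ Bv 0 \<and> x $ Bv 1 = y $ Bv 1 \<and> x $ Bv 2 = y $ Bv 2"
proof -
  have "x = y \<longleftrightarrow> (\<forall>i\<in>UNIV. x $ i = y $ i)"
    by (simp add: vec_eq_iff)
  then show ?thesis
    by (simp add: UNIV_ix)
qed

lemma mul_split_cayley:
  fixes x y :: "'f::field ^ cayley_ix"
  defines "z \<equiv> mul split_cayley x y"
  shows "z $ Be1 = x $ Be1 * y $ Be1 - x $ Bu 0 * y $ Bv 0 - x $ Bu 1 * y $ Bv 1 - x $ Bu 2 * y $ Bv 2"
    "z $ Be2 = x $ Be2 * y $ Be2 - x $ Bv 0 * y $ Bu 0 - x $ Bv 1 * y $ Bu 1 - x $ Bv 2 * y $ Bu 2"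
    "z $ Bu 0 = x $ Be1 * y $ Bu 0 + x $ Bu 0 * y $ Be2 + x $ Bv 1 * y $ Bv 2 - x $ Bv 2 * y $ Bv 1"
    "z $ Bu 1 = x $ Be1 * y $ Bu 1 + x $ Bu 1 * y $ Be2 + x $ Bv 2 * y $ Bv 0 - x $ Bv 0 * y $ Bv 2"
    "z $ Bu 2 = x $ Be1 * y $ Bu 2 + x $ Bu 2 * y $ Be2 + x $ Bv 0 * y $ Bv 1 - x $ Bv 1 * y $ Bv 0"
    "z $ Bv 0 = x $ Be2 * y $ Bv 0 + x $ Bv 0 * y $ Be1 + x $ Bu 1 * y $ Bu 2 - x $ Bu 2 * y $ Bu 1"
    "z $ Bv 1 = x $ Be2 * y $ Bv 1 + x $ Bv 1 * y $ Be1 + x $ Bu 2 * y $ Bu 0 - x $ Bu 0 * y $ Bu 2"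
    "z $ Bv 2 = x $ Be2 * y $ Bv 2 + x $ Bv 2 * y $ Be1 + x $ Bu 0 * y $ Bu 1 - x $ Bu 1 * y $ Bu 0"
  by (simp_all add: z_def split_cayley_def sum_ix three_arith axis_def)

lemma nrm_split_cayley:
  "nrm split_cayley x = x $ Be1 * x $ Be2 + x $ Bu 0 * x $ Bv 0 + x $ Bu 1 * x $ Bv 1 + x $ Bu 2 * x $ Bv 2"
  using sum_3[of "\<lambda>i. x $ Bu i * x $ Bv i"]
  by (simp add: split_cayley_def three_arith(1) add_ac)

lemma unity_split_cayley: "unity split_cayley = (bvec Be1 + bvec Be2 :: 'f::field ^ cayley_ix)"
proof -
  have 1: "is_unity split_cayley (bvec Be1 + bvec Be2 :: 'f ^ cayley_ix)"
    unfolding is_unity_def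
  proof (intro conjI ballI)
    show "bvec Be1 + bvec Be2 \<noteq> (0 :: 'f ^ cayley_ix)"
      by (simp add: vec_ix_eq axis_def)
  qed (simp add: split_cayley_def, simp_all add: vec_ix_eq mul_split_cayley, simp_all add: axis_def)
  show ?thesis
    unfolding unity_def
  proof (rule the_equality[where P = "is_unity split_cayley", OF 1])
    fix u :: "'f ^ cayley_ix"
    assume "is_unity split_cayley u"
    then show "u = bvec Be1 + bvec Be2"
      using 1 by (metis is_unity_def)
  qed
qed

lemma conj_split_cayley:
  fixes x :: "'f::field ^ cayley_ix"
  defines "z \<equiv> conj_std split_cayley x"
  shows "z $ Be1 = x $ Be2" "z $ Be2 = x $ Be1" "z $ Bu i = - (x $ Bu i)" "z $ Bv i = - (x $ Bv i)"
  by (simp_all add: z_def conj_std_def unity_split_cayley polar_def nrm_split_cayley axis_def)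
    (simp_all add: split_cayley_def axis_def algebra_simps)

lemma tau_st_coords:
  "tau_st x $ Be1 = x $ Be1" "tau_st x $ Be2 = x $ Be2"
  "tau_st x $ Bu 0 = x $ Bu 2" "tau_st x $ Bu 1 = x $ Bu 0" "tau_st x $ Bu 2 = x $ Bu 1"
  "tau_st x $ Bv 0 = x $ Bv 2" "tau_st x $ Bv 1 = x $ Bv 0" "tau_st x $ Bv 2 = x $ Bv 1"
  by (simp_all add: tau_st_def sum_ix three_arith axis_def)

lemma mul_split_okubo:
  "mul split_okubo x y = mul split_cayley (tau_st (conj_std split_cayley x))
     (tau_st (tau_st (conj_std split_cayley y)))"
  by (simp add: split_okubo_def petersson_def)

lemmas split_coords = mul_split_okubo mul_split_cayley tau_st_coords conj_split_cayley

lemma split_okubo_simps [simp]: "vecs split_okubo = UNIV" "scl split_okubo = (*s)"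
  by (simp_all add: split_okubo_def petersson_def split_cayley_def)

lemma nrm_split_okubo: "nrm split_okubo = nrm split_cayley"
  by (simp_all add: split_okubo_def petersson_def split_cayley_def)

lemma split_okubo_sym1:
  "mul split_okubo (mul split_okubo x y) x = nrm split_okubo x *s (y :: 'f::field ^ cayley_ix)"
  by (simp add: vec_ix_eq split_coords nrm_split_okubo nrm_split_cayley algebra_simps)

lemma split_okubo_sym2:
  "mul split_okubo x (mul split_okubo y x) = nrm split_okubo x *s (y :: 'f::field ^ cayley_ix)"
  by (simp add: vec_ix_eq split_coords nrm_split_okubo nrm_split_cayley algebra_simps)

lemma split_okubo_bilinear:
  "mul split_okubo (x + y) z = mul split_okubo x z + mul split_okubo y z"
  "mul split_okubo z (x + y) = mul split_okubo z x + mul split_okubo z y"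
  "mul split_okubo (c *s x) z = c *s mul split_okubo x z"
  "mul split_okubo z (c *s x) = c *s mul split_okubo z x"
  for x y z :: "'f::field ^ cayley_ix"
  by (simp_all add: vec_ix_eq split_coords algebra_simps)

lemma quad_space_split_okubo: "quad_space (*s) (nrm split_okubo :: 'f::field ^ cayley_ix \<Rightarrow> 'f)"
  by unfold_locales
    (simp_all add: pol_def nrm_split_okubo nrm_split_cayley power2_eq_square algebra_simps)

lemma split_okubo_nondegenerate: "nondegenerate (nrm split_okubo :: 'f::field ^ cayley_ix \<Rightarrow> 'f)"
  unfolding nondegenerate_def
proof (intro allI impI)
  fix x :: "'f ^ cayley_ix"
  assume *: "\<forall>y. pol (nrm split_okubo) x y = 0"
  show "x = 0"
    using *[rule_format, of "bvec Be1"] *[rule_format, of "bvec Be2"]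
      *[rule_format, of "bvec (Bu 0)"] *[rule_format, of "bvec (Bu 1)"] *[rule_format, of "bvec (Bu 2)"]
      *[rule_format, of "bvec (Bv 0)"] *[rule_format, of "bvec (Bv 1)"] *[rule_format, of "bvec (Bv 2)"]
    by (simp add: pol_def nrm_split_okubo nrm_split_cayley vec_ix_eq axis_def algebra_simps)
qed

lemma split_okubo_centre:
  fixes p :: "'f::field ^ cayley_ix"
  assumes *: "\<And>x. mul split_okubo p x = mul split_okubo x p"
  shows "p = 0"
  using *[of "bvec Be1"] *[of "bvec Be2"]
      *[of "bvec (Bu 0)"] *[of "bvec (Bu 1)"] *[of "bvec (Bu 2)"]
      *[of "bvec (Bv 0)"] *[of "bvec (Bv 1)"] *[of "bvec (Bv 2)"] 
  by (simp add: vec_ix_eq split_coords axis_def)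

section \<open>Descent from the split Okubo algebra\<close>

lemma is_iso_comp:
  assumes "is_iso A B \<phi>" "is_iso B C \<psi>"
  shows "is_iso A C (\<psi> \<circ> \<phi>)"
proof -
  have "\<phi> x \<in> vecs B" if "x \<in> vecs A" for x
    using assms(1) that unfolding is_iso_def by (auto dest: bij_betwE)
  then show ?thesis
    using assms unfolding is_iso_def by (auto intro: bij_betw_trans)
qed

lemma is_iso_inv:
  assumes iso: "is_iso A B \<phi>"
    and closed: "\<And>x y. x \<in> vecs A \<Longrightarrow> y \<in> vecs A \<Longrightarrow> x + y \<in> vecs A"
      "\<And>a x. x \<in> vecs A \<Longrightarrow> scl A a x \<in> vecs A"
      "\<And>x y. x \<in> vecs A \<Longrightarrow> y \<in> vecs A \<Longrightarrow> mul A x y \<in> vecs A"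
  shows "is_iso B A (inv_into (vecs A) \<phi>)"
proof -
  let ?\<theta> = "inv_into (vecs A) \<phi>"
  have bij: "bij_betw \<phi> (vecs A) (vecs B)"
    using iso by (simp add: is_iso_def)
  have \<theta>: "?\<theta> y \<in> vecs A" "\<phi> (?\<theta> y) = y" if "y \<in> vecs B" for y
    using bij that by (auto simp: bij_betw_def inv_into_into f_inv_into_f)
  have eq: "?\<theta> y = x" if "x \<in> vecs A" "\<phi> x = y" for x y
    using bij that by (auto simp: bij_betw_def)
  show ?thesis
    unfolding is_iso_def
  proof (intro conjI allI ballI)
    show "bij_betw ?\<theta> (vecs B) (vecs A)"
      using bij by (rule bij_betw_inv_into)
    show "?\<theta> (x + y) = ?\<theta> x + ?\<theta> y" if "x \<in> vecs B" "y \<in> vecs B" for x y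
      using iso that \<theta> by (intro eq closed) (simp_all add: is_iso_def)
    show "?\<theta> (scl B a x) = scl A a (?\<theta> x)" if "x \<in> vecs B" for a x
      using iso that \<theta> by (intro eq closed) (simp_all add: is_iso_def)
    show "?\<theta> (mul B x y) = mul A (?\<theta> x) (?\<theta> y)" if "x \<in> vecs B" "y \<in> vecs B" for x y
      using iso that \<theta> by (intro eq closed) (simp_all add: is_iso_def)
    show "nrm A (?\<theta> x) = nrm B x" if "x \<in> vecs B" for x
      using iso that \<theta> by (metis is_iso_def)
  qed
qed

lemma is_iso_inv_total:
  "is_iso A B \<phi> \<Longrightarrow> vecs A = UNIV \<Longrightarrow> is_iso B A (inv \<phi>)"
  using is_iso_inv[of A B \<phi>] by simp

lemma field_embedding_simps:
  assumes "field_embedding h"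
  shows "h 1 = 1" "h (a + b) = h a + h b" "h (a * b) = h a * h b" "h 0 = 0" "h (- a) = - h a"
    "h (a - b) = h a - h b" "h (a\<^sup>2) = (h a)\<^sup>2" "inj h"
proof -
  show 1: "h 1 = 1" "h (a + b) = h a + h b" "h (a * b) = h a * h b" for a b
    using assms by (simp_all add: field_embedding_def)
  show 0: "h 0 = 0"
    using 1(2)[of 0 0] by (metis add.right_neutral add_left_cancel)
  show m: "h (- a) = - h a" for a
    using 1(2)[of a "- a"] by (simp add: 0 minus_unique)
  show d: "h (a - b) = h a - h b" for a b
    using 1(2)[of a "- b"] by (simp add: m)
  show "h (a\<^sup>2) = (h a)\<^sup>2"
    by (simp add: power2_eq_square 1)
  have "a = 0" if "h a = 0" for a
    using 1(3)[of a "inverse a"] that by (cases "a = 0") (simp_all add: 1)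
  then show "inj h"
    by (metis d injI right_minus_eq)
qed

lemma three_nonzero: "CHAR('f::field) \<noteq> 3 \<Longrightarrow> (3::'f) \<noteq> 0"
proof
  assume char: "CHAR('f) \<noteq> 3" and "(3::'f) = 0"
  then have "CHAR('f) dvd 3"
    by (metis of_nat_eq_0_iff_char_dvd of_nat_numeral)
  moreover from this have "CHAR('f) \<le> 3"
    by (rule dvd_imp_le) simp
  then have "CHAR('f) = 0 \<or> CHAR('f) = Suc 0 \<or> CHAR('f) = 2 \<or> CHAR('f) = 3"
    by linarith
  ultimately show False
    using char CHAR_not_1[where 'a = 'f] by auto
qed

lemma oct_inj_imp_surj:
  fixes g :: "'f::field oct \<Rightarrow> 'f ^ cayley_ix"
  assumes add: "\<And>x y. g (x + y) = g x + g y" and scl: "\<And>a x. g (o_scl a x) = a *s g x"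
    and inj: "inj g"
  shows "surj g"
proof -
  define t :: "'f ^ cayley_ix \<Rightarrow> 'f oct" where
    "t x = (((x $ Be1, x $ Be2), (x $ Bu 0, x $ Bu 1)), ((x $ Bu 2, x $ Bv 0), (x $ Bv 1, x $ Bv 2)))" for x
  have "Vector_Spaces.linear (*s) (*s) (g \<circ> t)"
  proof -
    have "t (x + y) = t x + t y" "t (a *s x) = o_scl a (t x)" for x y a
      by (simp_all add: t_def o_scl_def h_defs)
    then show ?thesis
      by (simp add: Vector_Spaces.linear_iff add scl vec.vector_space_axioms)
  qed
  moreover have "inj t"
    by (rule injI) (simp add: t_def vec_ix_eq)
  ultimately have "surj (g \<circ> t)"
    using inj by (intro vec.linear_inj_imp_surj inj_compose)
  then show ?thesis
    unfolding surj_def comp_apply by blast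
qed

lemma okubo_idem8_of_embedding:
  fixes h :: "'f::field \<Rightarrow> 'k::field" and \<kappa> :: "'f ^ cayley_ix \<Rightarrow> 'k ^ cayley_ix"
  assumes h: "field_embedding h" and three: "(3::'f) \<noteq> 0"
    and inj: "inj \<kappa>" and add: "\<And>x y. \<kappa> (x + y) = \<kappa> x + \<kappa> y" and scl: "\<And>a x. \<kappa> (a *s x) = h a *s \<kappa> x"
    and mul: "\<And>x y. \<kappa> (st x y) = mul split_okubo (\<kappa> x) (\<kappa> y)"
    and nrm: "\<And>x. nrm split_okubo (\<kappa> x) = h (n x)"
    and span: "vec.span (range \<kappa>) = UNIV"
    and e: "st e e = e" "e \<noteq> 0"
  shows "okubo_idem8 (*s) n st e"
proof -
  interpret S: quad_space "(*s)" "nrm split_okubo :: 'k ^ cayley_ix \<Rightarrow> 'k"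
    by (rule quad_space_split_okubo)
  note hs = field_embedding_simps(1-7)[OF h]
  have heq: "h a = h b \<longleftrightarrow> a = b" for a b
    using field_embedding_simps(8)[OF h] by (simp add: inj_eq)
  have keq: "x = y" if "\<kappa> x = \<kappa> y" for x y
    using inj that by (simp add: inj_eq)
  have pol: "h (pol n x y) = pol (nrm split_okubo) (\<kappa> x) (\<kappa> y)" for x y
    by (simp add: pol_def hs nrm flip: add)
  have pol0: "(\<forall>y. pol n x y = 0) \<Longrightarrow> \<kappa> x = 0" for x
  proof -
    assume *: "\<forall>y. pol n x y = 0"
    have "pol (nrm split_okubo) (\<kappa> x) z = 0" for z
    proof -
      have "z \<in> vec.span (range \<kappa>)"
        using span by simp
      then show ?thesis
      proof (induction rule: vec.span_induct_alt)
        case (step c y z)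
        then show ?case
          using * hs(4) by (auto simp: S.pol_simps simp flip: pol)
      qed simp
    qed
    then show ?thesis
      using split_okubo_nondegenerate unfolding nondegenerate_def by blast
  qed
  have k0: "\<kappa> 0 = 0"
    using add[of 0 0] by simp
  have centre: "\<kappa> p = 0" if *: "\<And>x. st p x = st x p" for p
  proof (rule split_okubo_centre)
    fix z
    have "z \<in> vec.span (range \<kappa>)"
      using span by simp
    then show "mul split_okubo (\<kappa> p) z = mul split_okubo z (\<kappa> p)"
    proof (induction rule: vec.span_induct_alt)
      case base
      show ?case
        using split_okubo_bilinear(3)[of 0 0 "\<kappa> p"] split_okubo_bilinear(4)[of "\<kappa> p" 0 0] by simp
    next
      case (step c y z)
      then show ?case
        using * by (auto simp: split_okubo_bilinear simp flip: mul)
    qed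
  qed
  show ?thesis
  proof
    show "n (a *s x) = a\<^sup>2 * n x" for a x
      using S.n_scale[of "h a" "\<kappa> x"] by (simp add: nrm hs heq flip: scl) (simp flip: hs add: heq)
    show "pol n (x + y) z = pol n x z + pol n y z" for x y z
      by (simp add: hs pol add S.pol_simps flip: heq)
    show "pol n (a *s x) y = a * pol n x y" for a x y
      by (simp add: hs pol scl S.pol_simps flip: heq)
    show "st (x + y) z = st x z + st y z" "st z (x + y) = st z x + st z y"
      "st (a *s x) y = a *s st x y" "st x (a *s y) = a *s st x y" for a x y z
      by (rule keq, simp add: mul add scl split_okubo_bilinear)+
    show "st (st x y) x = n x *s y" "st x (st y x) = n x *s y" for x y
      by (rule keq, simp add: mul scl split_okubo_sym1 split_okubo_sym2 nrm)+
    show "nondegenerate n"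
      unfolding nondegenerate_def using pol0 k0 keq by metis
    show "p = 0" if "\<And>x. st p x = st x p" for p
      using centre[OF that] k0 keq by metis
    show "surj g" if "\<And>x y. g (x + y) = g x + g y" "\<And>a x. g (o_scl a x) = a *s g x" "inj g"
      for g :: "'f oct \<Rightarrow> 'f ^ cayley_ix"
      using that by (rule oct_inj_imp_surj)
  qed (use three e in auto)
qed

lemma okubo_coordinates:
  fixes A :: "('f::field, 'a::ab_group_add) qalg" and h :: "'f \<Rightarrow> 'k::field"
  assumes A: "okubo_algebra h A" and three: "(3::'f) \<noteq> 0"
  obtains j :: "'f ^ cayley_ix \<Rightarrow> 'a" and st n where
    "is_iso (total_alg (*s) st n) A j" "\<And>e. st e e = e \<Longrightarrow> e \<noteq> 0 \<Longrightarrow> okubo_idem8 (*s) n st e"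
proof -
  obtain AK :: "('k, 'k ^ cayley_ix) qalg" and \<iota> \<phi> where
    awf: "algebra_with_form A" and h: "field_embedding h" and
    ext: "scalar_extension h A AK \<iota>" and \<phi>: "is_iso AK split_okubo \<phi>"
    using A unfolding okubo_algebra_def isomorphic_def by blast
  interpret VA: vector_space "scl A"
    using awf by (simp add: algebra_with_form_def)
  interpret VK: vector_space "scl AK"
    using ext by (simp add: scalar_extension_def algebra_with_form_def)
  have subA: "VA.subspace (vecs A)" and bilA: "bilinear_product A"
    using awf by (simp_all add: algebra_with_form_def)
  have subK: "VK.subspace (vecs AK)" and bilK: "bilinear_product AK"
    using ext by (simp_all add: scalar_extension_def algebra_with_form_def)
  obtain B where B: "B \<subseteq> vecs A" "VA.independent B" "vecs A \<subseteq> VA.span B"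
    by (rule VA.maximal_independent_subset)
  then have spB: "VA.span B = vecs A"
    using subA by (intro VA.span_subspace)
  have "is_basis A B"
    using B spB by (simp add: is_basis_def)
  then have injB: "inj_on \<iota> B" and basK: "is_basis AK (\<iota> ` B)"
    using ext by (auto simp: scalar_extension_def)
  define \<theta> where "\<theta> = inv_into (vecs AK) \<phi>"
  have \<theta>: "is_iso split_okubo AK \<theta>"
    unfolding \<theta>_def using \<phi> bilK subK
    by (intro is_iso_inv) (auto simp: bilinear_product_def VK.subspace_def)
  have lin\<theta>: "Vector_Spaces.linear (*s) (scl AK) \<theta>"
    using \<theta> by (simp add: is_iso_def Vector_Spaces.linear_iff VK.vector_space_axioms vec.vector_space_axioms)
  have bij\<theta>: "bij_betw \<theta> UNIV (vecs AK)" and bij\<phi>: "bij_betw \<phi> (vecs AK) UNIV"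
    using \<theta> \<phi> by (simp_all add: is_iso_def)
  have inj\<theta>: "inj \<theta>"
    using bij\<theta> by (simp add: bij_betw_def)
  have \<theta>\<phi>: "\<theta> (\<phi> x) = x" if "x \<in> vecs AK" for x
    using bij\<phi> that by (simp add: \<theta>_def bij_betw_def)
  interpret P: vector_space_pair "(*s) :: 'k \<Rightarrow> 'k ^ cayley_ix \<Rightarrow> 'k ^ cayley_ix" "scl AK" ..
  have "VK.independent (\<theta> ` cart_basis)"
    using inj\<theta> by (intro P.linear_independent_injective_image[OF lin\<theta> independent_cart_basis]) (auto intro: inj_on_subset)
  moreover have sp\<theta>: "VK.span (\<theta> ` S) = \<theta> ` vec.span S" for S
    by (rule P.linear_span_image[OF lin\<theta>])
  moreover have "\<theta> ` UNIV = vecs AK"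
    using bij\<theta> by (simp add: bij_betw_def)
  ultimately have "VK.dim (vecs AK) = card (\<theta> ` (cart_basis :: ('k ^ cayley_ix) set))"
    using subK by (intro VK.dim_eq_card) (simp_all add: VK.span_eq_iff[THEN iffD2])
  also have "\<dots> = CARD(cayley_ix)"
    using inj\<theta> by (simp add: card_image inj_on_subset[OF inj\<theta>] card_cart_basis)
  finally have dimK: "VK.dim (vecs AK) = CARD(cayley_ix)" .
  have "VK.dim (vecs AK) = card (\<iota> ` B)"
    using basK subK by (intro VK.dim_eq_card) (simp_all add: is_basis_def VK.span_eq_iff[THEN iffD2])
  then have cardB: "card B = CARD(cayley_ix)"
    using injB dimK by (simp add: card_image)
  then have finB: "finite B"
    by (metis card.infinite finite_UNIV_card_ge_0 finite_class.finite_UNIV less_irrefl)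
  have \<iota>B: "\<iota> ` B \<subseteq> vecs AK"
    using basK by (simp add: is_basis_def)
  define G where "G = \<phi> ` \<iota> ` B"
  have "\<theta> ` G = \<iota> ` B"
    using \<iota>B \<theta>\<phi> by (force simp: G_def image_iff)
  then have "\<theta> ` vec.span G = \<theta> ` UNIV"
    using sp\<theta>[of G] basK \<open>\<theta> ` UNIV = vecs AK\<close> by (simp add: is_basis_def)
  then have spG: "vec.span G = UNIV"
    using inj\<theta> by (metis inj_image_eq_iff)
  have "inj_on (\<phi> \<circ> \<iota>) B"
    using injB \<iota>B bij\<phi> by (intro comp_inj_on) (auto simp: bij_betw_def intro: inj_on_subset)
  obtain b where b: "bij_betw b (UNIV :: cayley_ix set) B"
    using cardB finB by (metis finite_class.finite_UNIV finite_same_card_bij)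
  define c where "c i = \<phi> (\<iota> (b i))" for i
  have injc: "inj c" and rangec: "range c = G"
  proof -
    have "bij_betw ((\<phi> \<circ> \<iota>) \<circ> b) UNIV G"
      using b \<open>inj_on (\<phi> \<circ> \<iota>) B\<close> by (intro bij_betw_trans[of b UNIV B]) (auto simp: bij_betw_def G_def image_comp)
    moreover have "(\<phi> \<circ> \<iota>) \<circ> b = c"
      by (auto simp: c_def)
    ultimately show "inj c" "range c = G"
      by (simp_all add: bij_betw_def)
  qed
  have indG: "vec.independent G"
  proof (rule vec.card_le_dim_spanning[of G UNIV])
    show "card G \<le> vec.dim (UNIV :: ('k ^ cayley_ix) set)"
      using injc rangec card_image[of c UNIV] by (metis order_refl vec_dim_card)
  qed (use spG rangec in auto)
  define j where "j x = (\<Sum>i\<in>UNIV. scl A (x $ i) (b i))" for x :: "'f ^ cayley_ix"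
  have bA: "b i \<in> vecs A" for i
    using b B(1) by (auto simp: bij_betw_def)
  have jA: "j x \<in> vecs A" for x
    unfolding j_def by (intro VA.subspace_sum VA.subspace_scale subA bA)
  have j_add: "j (x + y) = j x + j y" for x y
    by (simp add: j_def VA.scale_left_distrib sum.distrib)
  have j_scl: "j (a *s x) = scl A a (j x)" for a x
    by (simp add: j_def VA.scale_sum_right)
  define \<kappa> where "\<kappa> x = \<phi> (\<iota> (j x))" for x
  have k_in: "\<iota> x \<in> vecs AK" if "x \<in> vecs A" for x
    using ext that by (simp add: scalar_extension_def)
  have k_add: "\<phi> (\<iota> (x + y)) = \<phi> (\<iota> x) + \<phi> (\<iota> y)" if "x \<in> vecs A" "y \<in> vecs A" for x y
    using ext \<phi> that by (simp add: scalar_extension_def is_iso_def)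
  have k_scl: "\<phi> (\<iota> (scl A a x)) = h a *s \<phi> (\<iota> x)" if "x \<in> vecs A" for a x
    using ext \<phi> that by (simp add: scalar_extension_def is_iso_def)
  have k_mul: "\<phi> (\<iota> (mul A x y)) = mul split_okubo (\<phi> (\<iota> x)) (\<phi> (\<iota> y))" if "x \<in> vecs A" "y \<in> vecs A" for x y
    using ext \<phi> that by (simp add: scalar_extension_def is_iso_def)
  have k_nrm: "nrm split_okubo (\<phi> (\<iota> x)) = h (nrm A x)" if "x \<in> vecs A" for x
    using ext \<phi> that by (simp add: scalar_extension_def is_iso_def)
  have k_0: "\<phi> (\<iota> 0) = 0"
    using k_add[of 0 0] subA by (simp add: VA.subspace_0)
  have k_sum: "\<phi> (\<iota> (\<Sum>i\<in>I. f i)) = (\<Sum>i\<in>I. \<phi> (\<iota> (f i)))" if "finite I" "\<And>i. f i \<in> vecs A" for I and f :: "cayley_ix \<Rightarrow> 'a"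
    using that(1) by induction (simp_all add: k_0 k_add that(2) VA.subspace_sum[OF subA])
  have \<kappa>_eq: "\<kappa> x = (\<Sum>i\<in>UNIV. h (x $ i) *s c i)" for x
    by (simp add: \<kappa>_def j_def k_sum VA.subspace_scale[OF subA] bA k_scl c_def)
  have \<kappa>_add: "\<kappa> (x + y) = \<kappa> x + \<kappa> y" and \<kappa>_scl: "\<kappa> (a *s x) = h a *s \<kappa> x" for x y a
    by (simp_all add: \<kappa>_def j_add j_scl k_add k_scl jA)
  have \<kappa>0: "x = 0" if "\<kappa> x = 0" for x
  proof -
    have "(\<Sum>v\<in>G. h (x $ inv c v) *s v) = \<kappa> x"
      unfolding \<kappa>_eq rangec[symmetric] using injc by (simp add: sum.reindex)
    then have "h (x $ inv c v) = 0" if "v \<in> G" for v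
      using vec.independentD[OF indG _ order_refl, of "\<lambda>v. h (x $ inv c v)" v] that \<open>\<kappa> x = 0\<close> rangec
      by (metis finite_imageI finite_class.finite_UNIV)
    then have "h (x $ i) = h 0" for i
      using injc rangec field_embedding_simps(4)[OF h] by (metis inv_f_f rangeI)
    then show ?thesis
      using field_embedding_simps(8)[OF h] by (simp add: vec_eq_iff inj_eq)
  qed
  have inj\<kappa>: "inj \<kappa>"
  proof (rule injI)
    fix x y assume "\<kappa> x = \<kappa> y"
    moreover have "\<kappa> (x - y) + \<kappa> y = \<kappa> x"
      by (simp flip: \<kappa>_add)
    ultimately show "x = y"
      using \<kappa>0[of "x - y"] by simp
  qed
  have "inj j"
    using inj\<kappa> by (metis \<kappa>_def injD injI)
  moreover have "range j = vecs A"
  proof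
    show "vecs A \<subseteq> range j"
    proof -
      have "VA.subspace (range j)"
        unfolding VA.subspace_def
      proof (intro conjI ballI allI)
        show "0 \<in> range j"
          by (rule range_eqI[of _ _ 0]) (simp add: j_def)
      qed (auto simp flip: j_add j_scl)
      moreover have "B \<subseteq> range j"
      proof
        fix v assume "v \<in> B"
        then obtain i where "v = b i"
          using b by (auto simp: bij_betw_def)
        moreover have "j (axis i 1) = b i"
          by (simp add: j_def axis_def if_distrib[of "\<lambda>a. scl A a _"] cong: if_cong)
        ultimately show "v \<in> range j" by (metis rangeI)
      qed
      ultimately show ?thesis
        using spB VA.span_minimal by metis
    qed
  qed (use jA in auto)
  ultimately have bijj: "bij_betw j UNIV (vecs A)"
    by (simp add: bij_betw_def)
  define st where "st x y = inv j (mul A (j x) (j y))" for x y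
  have j_st: "j (st x y) = mul A (j x) (j y)" for x y
  proof -
    have "mul A (j x) (j y) \<in> range j"
      using bilA jA \<open>range j = vecs A\<close> by (simp add: bilinear_product_def)
    then show ?thesis
      by (simp add: st_def f_inv_into_f)
  qed
  have "is_iso (total_alg (*s) st (\<lambda>x. nrm A (j x))) A j"
    by (simp add: is_iso_def bijj j_add j_scl j_st)
  moreover have "okubo_idem8 (*s) (\<lambda>x. nrm A (j x)) st e" if "st e e = e" "e \<noteq> 0" for e
  proof (rule okubo_idem8_of_embedding[OF h three inj\<kappa> \<kappa>_add \<kappa>_scl])
    show "\<kappa> (st x y) = mul split_okubo (\<kappa> x) (\<kappa> y)" for x y
      by (simp add: \<kappa>_def j_st k_mul jA)
    show "nrm split_okubo (\<kappa> x) = h (nrm A (j x))" for x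
      by (simp only: \<kappa>_def k_nrm jA)
    have "c i = \<kappa> (axis i 1)" for i
      by (simp add: \<kappa>_eq axis_def if_distrib[of h] field_embedding_simps[OF h]
          if_distrib[of "\<lambda>a. a *s _"] cong: if_cong)
    then have "G \<subseteq> range \<kappa>"
      using rangec by auto
    then show "vec.span (range \<kappa>) = UNIV"
      using spG vec.span_mono by blast
  qed (use that in auto)
  ultimately show ?thesis
    using that by blast
qed

section \<open>Conjugacy of idempotents\<close>

definition has_model :: "('f::field, 'a::ab_group_add) qalg \<Rightarrow> 'a \<Rightarrow> 'f \<Rightarrow> 'f \<Rightarrow> bool" where
  "has_model A e a b \<longleftrightarrow> a \<noteq> 0 \<and> b \<noteq> 0 \<and> (\<exists>\<psi>. is_iso (model a b) A \<psi> \<and> \<psi> o_one = e)"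

lemma has_model_rescale:
  assumes "has_model A e a b" "k_nrm k \<noteq> 0"
  shows "has_model A e (a * k_nrm k) b"
proof -
  obtain \<psi> where "is_iso (model a b) A \<psi>" "\<psi> o_one = e"
    using assms by (auto simp: has_model_def)
  moreover obtain \<rho> where "is_iso (model (a * k_nrm k) b) (model a b) \<rho>" "\<rho> o_one = o_one"
    using model_rescale[OF assms(2)] by blast
  ultimately have "is_iso (model (a * k_nrm k) b) A (\<psi> \<circ> \<rho>)" "(\<psi> \<circ> \<rho>) o_one = e"
    by (auto intro: is_iso_comp)
  then show ?thesis
    using assms unfolding has_model_def by auto
qed

lemma has_model_conjugate:
  assumes "has_model A e a b" "has_model A f a b"
  shows "conjugate A e f"
proof -
  obtain \<psi> where \<psi>: "is_iso (model a b) A \<psi>" "\<psi> o_one = e"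
    using assms by (auto simp: has_model_def)
  obtain \<rho> where \<rho>: "is_iso (model a b) A \<rho>" "\<rho> o_one = f"
    using assms by (auto simp: has_model_def)
  have "inj \<psi>"
    using \<psi> by (simp add: is_iso_def bij_betw_def)
  then have "(\<rho> \<circ> inv \<psi>) e = f"
    using \<psi>(2) \<rho>(2) by (metis comp_apply inv_f_f)
  moreover have "is_iso A A (\<rho> \<circ> inv \<psi>)"
    using \<psi> \<rho> by (intro is_iso_comp[OF is_iso_inv_total]) auto
  ultimately show ?thesis
    unfolding conjugate_def by blast
qed

lemma has_model_exists:
  fixes A :: "('f::field, 'a::ab_group_add) qalg" and h :: "'f \<Rightarrow> 'k::field"
  assumes A: "okubo_algebra h A" and three: "(3::'f) \<noteq> 0" and e: "is_idempotent A e"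
  shows "\<exists>a b. has_model A e a b"
    and "has_model A e a b \<Longrightarrow> h_nrm a d \<noteq> 0 \<Longrightarrow> \<exists>a'. has_model A e a' (b * h_nrm a d)"
proof -
  obtain j :: "'f ^ cayley_ix \<Rightarrow> 'a" and st n where
    j: "is_iso (total_alg (*s) st n) A j" and loc: "\<And>e. st e e = e \<Longrightarrow> e \<noteq> 0 \<Longrightarrow> okubo_idem8 (*s) n st e"
    by (rule okubo_coordinates[OF A three]) (rule that)
  have bij: "bij_betw j UNIV (vecs A)" and mul: "j (st x y) = mul A (j x) (j y)"
    and add: "j (x + y) = j x + j y" for x y
    using j by (simp_all add: is_iso_def)
  have inj: "inj j"
    using bij by (simp add: bij_betw_def)
  obtain e' where e': "e = j e'"
    using e bij by (auto simp: is_idempotent_def bij_betw_def)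
  have "j (st e' e') = j e'"
    using e by (simp add: is_idempotent_def mul e')
  then have "st e' e' = e'"
    using inj by (simp add: inj_eq)
  moreover have "j 0 = 0"
    using add[of 0 0] by simp
  then have "e' \<noteq> 0"
    using e by (auto simp: is_idempotent_def e')
  ultimately interpret okubo_idem8 "(*s)" n st e'
    by (rule loc)
  have has: "has_model A e a b" if "a \<noteq> 0" "b \<noteq> 0" "is_iso (model a b) (total_alg (*s) st n) \<psi>" "\<psi> o_one = e'" for a b \<psi>
    using that is_iso_comp[OF that(3) j] unfolding has_model_def e' by (metis comp_apply)
  show "\<exists>a b. has_model A e a b"
    using idem_model has by blast
  assume hm: "has_model A e a b" and d: "h_nrm a d \<noteq> 0"
  then obtain \<psi> where b: "b \<noteq> 0" and \<psi>: "is_iso (model a b) A \<psi>" "\<psi> o_one = e"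
    by (auto simp: has_model_def)
  have "is_iso (model a b) (total_alg (*s) st n) (inv j \<circ> \<psi>)"
    using \<psi>(1) is_iso_inv_total[OF j] by (auto intro: is_iso_comp)
  moreover have "(inv j \<circ> \<psi>) o_one = e'"
    using \<psi>(2) inj by (simp add: e')
  ultimately show "\<exists>a'. has_model A e a' (b * h_nrm a d)"
    using idem_model_change[OF _ _ d b] has b d by (metis mult_eq_0_iff)
qed

lemma o_star_quat: "o_star a b (p, 0) (q, 0) = (h_mul a (h_cj p) (h_cj q), 0)"
  by (cases p; cases q)
    (simp add: o_star_def o_mul_def o_tau_def o_cj_def h_w_def h_defs zero_prod_def)

lemma h_mul_one: "h_mul a ((1, 0), 0) p = p" "h_mul a p ((1, 0), 0) = p"
  by (cases p; simp add: h_defs zero_prod_def)+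

lemma h_cj_one: "h_cj ((1, 0), 0) = ((1, 0), 0)"
  by (simp add: h_defs)

lemma h_cj_cj: "h_cj (h_cj p) = p"
  by (cases p; simp add: h_defs)

lemma h_cj_eq: "h_cj p = h_scl (pol (h_nrm a) p ((1, 0), 0)) ((1, 0), 0) - p"
proof -
  obtain p1 p2 p3 p4 where "p = ((p1, p2), (p3, p4))"
    by (metis surj_pair)
  then show ?thesis
    by (simp add: h_defs pol_def zero_prod_def power2_eq_square algebra_simps)
qed

lemma centralizer_eq:
  assumes "(3::'f::field) \<noteq> 0" and \<psi>: "is_iso (model (a::'f) b) A \<psi>" "\<psi> o_one = e"
  shows "centralizer A e = range (\<lambda>p. \<psi> (p, 0))"
proof -
  have inj: "inj \<psi>" and range: "range \<psi> = vecs A" and mul: "\<psi> (o_star a b x y) = mul A (\<psi> x) (\<psi> y)" for x y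
    using \<psi>(1) by (simp_all add: is_iso_def bij_betw_def del: split_paired_All)
  have C: "\<psi> x \<in> centralizer A e \<longleftrightarrow> snd x = 0" for x
  proof -
    have "\<psi> x \<in> centralizer A e \<longleftrightarrow> \<psi> (o_star a b o_one x) = \<psi> (o_star a b x o_one)"
      using range by (auto simp: centralizer_def mul \<psi>(2))
    also have "\<dots> \<longleftrightarrow> x \<in> centralizer (model a b) o_one"
      using inj by (simp add: inj_eq centralizer_def)
    finally show ?thesis
      using centralizer_model[OF assms(1)] by blast
  qed
  show ?thesis
  proof
    show "range (\<lambda>p. \<psi> (p, 0)) \<subseteq> centralizer A e"
      by (rule image_subsetI) (simp add: C)
    show "centralizer A e \<subseteq> range (\<lambda>p. \<psi> (p, 0))"
    proof
      fix y assume y: "y \<in> centralizer A e"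
      then have "y \<in> range \<psi>"
        by (simp add: centralizer_def range)
      then obtain x where x: "y = \<psi> x"
        by (rule rangeE)
      then have "y = \<psi> (fst x, 0)"
        using C y by (metis prod.collapse)
      then show "y \<in> range (\<lambda>p. \<psi> (p, 0))"
        by (rule range_eqI)
    qed
  qed
qed

lemma unity_eqI: "is_unity A u \<Longrightarrow> unity A = u"
  unfolding unity_def by (rule the_equality) (assumption, metis is_unity_def)

lemma quaternion_of_simps [simp]:
  "vecs (quaternion_of A e) = centralizer A e" "scl (quaternion_of A e) = scl A"
  "nrm (quaternion_of A e) = nrm A"
  "mul (quaternion_of A e) x y = mul A (mul A e x) (mul A y e)"
  by (simp_all add: quaternion_of_def)

lemma restrict_to_simps [simp]:
  "vecs (restrict_to A S) = S" "scl (restrict_to A S) = scl A"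
  "nrm (restrict_to A S) = nrm A" "mul (restrict_to A S) = mul A"
  "restrict_to (restrict_to A T) S = restrict_to A S"
  by (simp_all add: restrict_to_def)

lemma polar_pol: "polar A = pol (nrm A)"
  by (simp add: polar_def pol_def fun_eq_iff)

lemma alg_K_mul: "mul alg_K [:a, b:] [:c, d:] = [:a * c - b * d, a * d + b * c - b * (d::'f::field):]"
proof -
  have "[:a, b:] * [:c, d:] = [:a * c - b * d, a * d + b * c - b * d:] + [:b * d:] * [:1, 1, 1:]"
    by (simp add: algebra_simps)
  then have "([:a, b:] * [:c, d:]) mod [:1, 1, 1:] = [:a * c - b * d, a * d + b * c - b * d:] mod [:1, 1, 1:]"
    by (simp only: mod_mult_self1)
  also have "\<dots> = [:a * c - b * d, a * d + b * c - b * d:]"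
    by (rule mod_poly_less) simp
  finally show ?thesis
    by (simp add: alg_K_def algebra_simps)
qed

lemma alg_K_vecs: "p \<in> vecs alg_K \<longleftrightarrow> (\<exists>a b. p = [:a, b:])"
proof
  assume "p \<in> vecs alg_K"
  then have "degree p < 2" by (simp add: alg_K_def)
  then have "p = [:coeff p 0, coeff p 1:]"
    by (intro poly_eqI) (auto simp: coeff_pCons coeff_eq_0 split: nat.split)
  then show "\<exists>a b. p = [:a, b:]" by blast
qed (auto simp: alg_K_def)

lemma alg_K_scl: "scl alg_K = smult"
  by (simp add: alg_K_def)

lemma alg_K_nrm: "nrm alg_K [:a, b:] = k_nrm (a, b)"
  by (simp add: alg_K_def k_nrm_def)

lemma unity_alg_K: "unity alg_K = ([:1, 0:] :: 'f::field poly)"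
proof (rule unity_eqI)
  have "mul alg_K [:1, 0:] x = x \<and> mul alg_K x [:1, 0:] = x" if "x \<in> vecs alg_K" for x :: "'f poly"
    using that unfolding alg_K_vecs by (auto simp only: alg_K_mul) simp_all
  moreover have "[:1, 0:] \<in> vecs (alg_K :: ('f, 'f poly) qalg)"
    unfolding alg_K_vecs by blast
  ultimately show "is_unity alg_K ([:1, 0:] :: 'f poly)"
    by (simp add: is_unity_def)
qed

lemma conj_alg_K: "conj_std alg_K [:a, b:] = [:a - b, - b:]"
proof -
  have "polar alg_K [:a, b:] [:1, 0:] = 2 * a - b"
    unfolding polar_def add_pCons alg_K_nrm by (simp add: alg_K_nrm k_nrm_def power2_eq_square algebra_simps)
  then show ?thesis
    unfolding conj_std_def unity_alg_K alg_K_scl by (simp add: algebra_simps)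
qed

lemma para_K_simps: "vecs para_K = vecs alg_K" "scl para_K = smult" "nrm para_K = nrm alg_K"
  "mul para_K [:a, b:] [:c, d:] = mul alg_K [:a - b, - b:] [:c - d, - d:]"
  by (simp_all add: para_K_def para_hurwitz_def petersson_def alg_K_scl conj_alg_K)

lemma para_K_iso:
  fixes A :: "('f::field, 'a::ab_group_add) qalg"
  assumes \<psi>: "is_iso (model a b) A \<psi>"
  defines "S \<equiv> range (\<lambda>k. \<psi> ((k, 0), 0))"
  shows "isomorphic (restrict_to A S) (para_K :: ('f, 'f poly) qalg)" 
    "\<And>x y. x \<in> S \<Longrightarrow> y \<in> S \<Longrightarrow> x + y \<in> S" "\<And>c x. x \<in> S \<Longrightarrow> scl A c x \<in> S"
    "\<And>x y. x \<in> S \<Longrightarrow> y \<in> S \<Longrightarrow> mul A x y \<in> S" "0 \<in> S"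
proof -
  have inj: "inj \<psi>" and add: "\<psi> (x + y) = \<psi> x + \<psi> y" and scl: "\<psi> (o_scl c x) = scl A c (\<psi> x)"
    and mul: "\<psi> (o_star a b x y) = mul A (\<psi> x) (\<psi> y)" and nrm: "nrm A (\<psi> x) = o_nrm a b x" for x y c
    using \<psi> by (simp_all add: is_iso_def bij_betw_def del: split_paired_All)
  define f where "f k = \<psi> ((k, 0), 0)" for k
  have injf: "inj f"
    using inj by (auto simp: f_def inj_def simp del: split_paired_All)
  have f_add: "f (x + y) = f x + f y" for x y
    by (simp add: f_def flip: add)
  have f_scl: "f (k_scl c x) = scl A c (f x)" for x c
    by (simp add: f_def o_scl_def h_defs zero_prod_def flip: scl)
  have f_mul: "f (k_mul (k_cj x) (k_cj y)) = mul A (f x) (f y)" for x y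
  proof -
    have "o_star a b ((x, 0), 0) ((y, 0), 0) = ((k_mul (k_cj x) (k_cj y), 0), 0)"
      by (simp add: o_star_quat) (simp add: h_defs zero_prod_def)
    then show ?thesis
      by (simp add: f_def flip: mul)
  qed
  have f_nrm: "nrm A (f x) = k_nrm x" for x
    by (simp add: f_def nrm o_nrm_def h_defs)
  have S: "S = range f"
    by (simp add: S_def f_def)
  show "x + y \<in> S" "mul A x y \<in> S" if "x \<in> S" "y \<in> S" for x y
    using that by (auto simp: S simp flip: f_add f_mul)
  show "scl A c x \<in> S" if "x \<in> S" for x c
    using that by (auto simp: S simp flip: f_scl)
  show "0 \<in> S"
    using f_add[of 0 0] unfolding S by (intro range_eqI[of _ _ 0]) simp
  define g where "g p = f (coeff p 0, coeff p 1)" for p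
  have g: "g [:x, y:] = f (x, y)" for x y
    by (simp add: g_def)
  have "is_iso para_K (restrict_to A S) g"
    unfolding is_iso_def para_K_simps restrict_to_simps
  proof (intro conjI ballI allI)
    show "bij_betw g (vecs alg_K) S"
    proof (rule bij_betw_imageI)
      show "inj_on g (vecs alg_K)"
      proof (rule inj_onI)
        fix p q :: "'f poly" assume pq: "p \<in> vecs alg_K" "q \<in> vecs alg_K" "g p = g q"
        then obtain x y z w where "p = [:x, y:]" "q = [:z, w:]"
          by (auto simp: alg_K_vecs)
        then show "p = q"
          using pq(3) injD[OF injf, of "(x, y)" "(z, w)"] by (simp add: g)
      qed
      show "g ` vecs alg_K = S"
      proof
        show "g ` vecs alg_K \<subseteq> S"
          by (auto simp: S g_def)
        show "S \<subseteq> g ` vecs alg_K"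
        proof
          fix z assume "z \<in> S"
          then obtain x y where "z = f (x, y)"
            by (auto simp: S)
          then have "z = g [:x, y:]"
            by (simp only: g)
          then show "z \<in> g ` vecs alg_K"
            using alg_K_vecs by blast
        qed
      qed
    qed
  next
    fix p q :: "'f poly" assume "p \<in> vecs alg_K" "q \<in> vecs alg_K"
    then obtain x y z w where pq: "p = [:x, y:]" "q = [:z, w:]"
      by (auto simp: alg_K_vecs)
    show "g (p + q) = g p + g q"
      by (simp add: pq g flip: f_add)
    show "g (mul para_K p q) = mul A (g p) (g q)"
      unfolding pq para_K_simps alg_K_mul g by (simp add: k_mul_def k_cj_def flip: f_mul)
  next
    fix p :: "'f poly" and c assume "p \<in> vecs alg_K"
    then obtain x y where p: "p = [:x, y:]"
      by (auto simp: alg_K_vecs)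
    show "g (smult c p) = scl A c (g p)"
      by (simp add: p g k_scl_def dbl_scl_def flip: f_scl)
    show "nrm A (g p) = nrm alg_K p"
      by (simp add: p g f_nrm alg_K_nrm)
  qed
  then have "is_iso (restrict_to A S) para_K (inv_into (vecs para_K) g)"
  proof (rule is_iso_inv)
    fix p q :: "'f poly" and c :: 'f assume "p \<in> vecs para_K" "q \<in> vecs para_K"
    then obtain x y z w where pq: "p = [:x, y:]" "q = [:z, w:]"
      by (auto simp: alg_K_vecs para_K_simps)
    show "p + q \<in> vecs para_K" "mul para_K p q \<in> vecs para_K"
      unfolding pq para_K_simps alg_K_mul add_pCons by (auto simp: alg_K_vecs)
  next
    fix p :: "'f poly" and c :: 'f assume "p \<in> vecs para_K"
    then show "scl para_K c p \<in> vecs para_K"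
      by (auto simp: alg_K_vecs para_K_simps)
  qed
  then show "isomorphic (restrict_to A S) (para_K :: ('f, 'f poly) qalg)"
    by (auto simp: isomorphic_def)
qed

lemma idempotent_of_copy:
  fixes A :: "('f::field, 'a::ab_group_add) qalg"
  assumes "contains_copy A (para_K :: ('f, 'f poly) qalg)"
  shows "\<exists>e. is_idempotent A e"
proof -
  obtain S \<phi> where S: "is_subalgebra S A" and \<phi>: "is_iso (restrict_to A S) (para_K :: ('f, 'f poly) qalg) \<phi>"
    using assms by (auto simp: contains_copy_def isomorphic_def)
  have bij: "bij_betw \<phi> S (vecs alg_K)"
    and mul: "\<And>x y. x \<in> S \<Longrightarrow> y \<in> S \<Longrightarrow> \<phi> (mul A x y) = mul para_K (\<phi> x) (\<phi> y)"
    and add: "\<And>x y. x \<in> S \<Longrightarrow> y \<in> S \<Longrightarrow> \<phi> (x + y) = \<phi> x + \<phi> y"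
    using \<phi> by (simp_all add: is_iso_def para_K_simps(1))
  have "[:1, 0:] \<in> vecs (alg_K :: ('f, 'f poly) qalg)"
    unfolding alg_K_vecs by blast
  then obtain e where e: "e \<in> S" "\<phi> e = [:1, 0:]"
    using bij by (metis bij_betw_imp_surj_on imageE)
  have "\<phi> (mul A e e) = \<phi> e"
    unfolding mul[OF e(1) e(1)] e(2) para_K_simps alg_K_mul by simp
  moreover have "mul A e e \<in> S"
    using S e(1) by (simp add: is_subalgebra_def)
  ultimately have "mul A e e = e"
    using bij e(1) by (metis bij_betw_inv_into_left)
  moreover have "e \<noteq> 0"
  proof
    assume "e = 0"
    then have "\<phi> e + \<phi> e = \<phi> e + 0"
      using add[of e e] e(1) by simp
    then have "\<phi> e = 0"
      by (simp only: add_left_cancel)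
    then show False
      using e(2) by simp
  qed
  moreover have "e \<in> vecs A"
    using S e(1) by (auto simp: is_subalgebra_def)
  ultimately show ?thesis
    by (auto simp: is_idempotent_def)
qed

lemma centralizer_properties:
  fixes A :: "('f::field, 'a::ab_group_add) qalg"
  assumes awf: "algebra_with_form A" and three: "(3::'f) \<noteq> 0" and hm: "has_model A e a b"
  shows "is_subalgebra (centralizer A e) A"
    and "para_quaternion (restrict_to A (centralizer A e))"
    and "contains_copy (restrict_to A (centralizer A e)) (para_K :: ('f, 'f poly) qalg)"
    and "contains_copy A (para_K :: ('f, 'f poly) qalg)"
proof -
  obtain \<psi> where a: "a \<noteq> 0" and \<psi>: "is_iso (model a b) A \<psi>" "\<psi> o_one = e"
    using hm by (auto simp: has_model_def)
  interpret VA: vector_space "scl A"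
    using awf by (simp add: algebra_with_form_def)
  have subA: "VA.subspace (vecs A)" and bil: "bilinear_product A" and qf: "quadratic_form A"
    using awf by (simp_all add: algebra_with_form_def)
  have inj: "inj \<psi>" and add: "\<psi> (x + y) = \<psi> x + \<psi> y" and scl: "\<psi> (o_scl c x) = scl A c (\<psi> x)"
    and mul: "\<psi> (o_star a b x y) = mul A (\<psi> x) (\<psi> y)" and nrm: "nrm A (\<psi> x) = o_nrm a b x"
    and range: "range \<psi> = vecs A" for x y c
    using \<psi>(1) by (simp_all add: is_iso_def bij_betw_def del: split_paired_All)
  define f where "f p = \<psi> (p, 0)" for p
  have injf: "inj f"
    using inj by (auto simp: f_def inj_def simp del: split_paired_All)
  have f_add: "f (x + y) = f x + f y" for x y
    by (simp add: f_def flip: add)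
  have f_scl: "f (h_scl c x) = scl A c (f x)" for x c
    by (simp add: f_def o_scl_def h_defs zero_prod_def flip: scl)
  have f_mul: "mul A (f x) (f y) = f (h_mul a (h_cj x) (h_cj y))" for x y
    by (simp add: f_def o_star_quat flip: mul)
  have e: "e = f ((1, 0), 0)"
    using \<psi>(2) by (simp add: f_def o_one_def)
  have f_mul': "mul A (mul A e (f x)) (mul A (f y) e) = f (h_mul a x y)" for x y
    by (simp add: e f_mul h_cj_one h_mul_one h_cj_cj)
  have f_nrm: "nrm A (f x) = h_nrm a x" for x
    by (simp add: f_def nrm o_nrm_def dbl_nrm_def) (simp add: h_defs)
  have f_pol: "pol (nrm A) (f x) (f y) = pol (h_nrm a) x y" for x y
    by (simp add: pol_def f_nrm flip: f_add)
  have f_0: "f 0 = 0"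
    using f_add[of 0 0] by simp
  have f_diff: "f (x - y) = f x - f y" for x y
    using f_add[of "x - y" y] by simp
  have C: "centralizer A e = range f"
    using centralizer_eq[OF three \<psi>] by (simp add: f_def[abs_def])
  have CA: "range f \<subseteq> vecs A"
    using range by (auto simp: f_def)
  have subC: "VA.subspace (range f)"
    unfolding VA.subspace_def
  proof (intro conjI ballI allI)
    show "0 \<in> range f"
      using f_0 by (intro range_eqI[of _ _ 0]) simp
  qed (auto simp flip: f_add f_scl simp del: split_paired_All)
  show sub: "is_subalgebra (centralizer A e) A"
    unfolding is_subalgebra_def C using subC CA by (auto simp: f_mul)
  define Q where "Q = quaternion_of A e"
  have Qpolar: "polar Q = pol (nrm A)"
    by (simp add: polar_pol Q_def)
  have vecsQ: "vecs Q = range f"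
    by (simp add: Q_def C)
  have unityQ: "is_unity Q e"
  proof -
    have "f ((1, 0), 0) \<noteq> f 0"
      using injf by (simp add: inj_eq zero_prod_def)
    then have "e \<noteq> 0"
      by (simp add: e f_0)
    moreover have "mul Q e x = x \<and> mul Q x e = x" if x: "x \<in> range f" for x
    proof -
      obtain p where p: "x = f p" using x by auto
      have "mul Q e (f p) = f p" "mul Q (f p) e = f p"
        using f_mul'[of "((1, 0), 0)" p] f_mul'[of p "((1, 0), 0)"]
        by (simp_all add: Q_def h_mul_one flip: e)
      then show ?thesis by (simp add: p)
    qed
    ultimately show ?thesis
      by (simp add: is_unity_def Q_def C) (simp add: e)
  qed
  have "composition_algebra Q"
    unfolding composition_algebra_def
  proof (intro conjI ballI)
    have mulA: "mul A x y \<in> vecs A" if "x \<in> vecs A" "y \<in> vecs A" for x y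
      using bil that by (simp add: bilinear_product_def)
    have eA: "e \<in> vecs A"
      using CA e by auto
    have inA: "x \<in> vecs A" if "x \<in> range f" for x
      using CA that by blast
    have "bilinear_product Q"
      unfolding bilinear_product_def Q_def quaternion_of_simps C
    proof (intro conjI ballI allI)
      show "mul A (mul A e x) (mul A y e) \<in> range f" if "x \<in> range f" "y \<in> range f" for x y
        using that by (auto simp: f_mul')
    qed (use bil eA in \<open>simp_all add: inA mulA bilinear_product_def\<close>)
    moreover have "quadratic_form Q"
      unfolding quadratic_form_def Qpolar
      using qf inA by (simp add: quadratic_form_def Q_def C polar_pol)
    ultimately show "algebra_with_form Q"
      using subC by (simp add: algebra_with_form_def Q_def C VA.vector_space_axioms)
    have rad: "x = 0" if "x \<in> polar_radical Q" for x
    proof -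
      have "x \<in> range f"
        using that by (simp add: polar_radical_def Q_def C)
      then obtain p where p: "x = f p"
        by blast
      have *: "\<forall>y\<in>range f. pol (nrm A) (f p) y = 0"
        using that unfolding polar_radical_def Qpolar vecsQ p by blast
      have "pol (h_nrm a) p q = 0" for q
        using bspec[OF *, of "f q"] by (simp add: f_pol)
      then have "p = 0"
        using nondegenerate_h[OF three a] unfolding nondegenerate_def by blast
      then show ?thesis
        by (simp add: p f_0)
    qed
    show "nonsingular Q"
      unfolding nonsingular_def using rad by (auto intro!: exI[of _ 0] simp: Q_def)
    show "nrm Q (mul Q x y) = nrm Q x * nrm Q y" if "x \<in> vecs Q" "y \<in> vecs Q" for x y
      using that by (auto simp: Q_def C f_mul' f_nrm h_nrm_mult)
  qed
  moreover have "VA.dim (range f) = 4"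
  proof -
    define t :: "'f ^ 4 \<Rightarrow> 'f quat" where "t x = ((x $ 1, x $ 2), (x $ 3, x $ 4))" for x
    have lin: "Vector_Spaces.linear (*s) (scl A) (f \<circ> t)"
    proof -
      have "t (x + y) = t x + t y" "t (c *s x) = h_scl c (t x)" for x y c
        by (simp_all add: t_def h_defs)
      then show ?thesis
        by (simp add: Vector_Spaces.linear_iff f_add f_scl vec.vector_space_axioms VA.vector_space_axioms)
    qed
    have "inj t"
      by (rule injI) (simp add: t_def vec_eq_iff forall_4)
    then have injft: "inj (f \<circ> t)"
      using injf by (rule inj_compose[rotated])
    have "surj t"
    proof (rule surjI)
      show "t (\<chi> i. if i = 1 then fst (fst p) else if i = 2 then snd (fst p) else if i = 3 then fst (snd p) else snd (snd p)) = p" for p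
        by (simp add: t_def)
    qed
    then have rangeft: "range (f \<circ> t) = range f"
      by (metis image_comp)
    interpret P: vector_space_pair "(*s) :: 'f \<Rightarrow> 'f ^ 4 \<Rightarrow> 'f ^ 4" "scl A" ..
    have "VA.independent ((f \<circ> t) ` cart_basis)"
      using injft by (intro P.linear_independent_injective_image[OF lin independent_cart_basis]) (auto intro: inj_on_subset)
    moreover have "VA.span ((f \<circ> t) ` cart_basis) = VA.span (range f)"
      using P.linear_span_image[OF lin, of cart_basis] rangeft subC
      by (simp add: VA.span_eq_iff[THEN iffD2])
    ultimately have "VA.dim (range f) = card ((f \<circ> t) ` cart_basis)"
      by (intro VA.dim_eq_card)
    also have "\<dots> = 4"
      using card_image[OF inj_on_subset[OF injft subset_UNIV], of cart_basis] by (simp add: card_cart_basis)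
    finally show ?thesis .
  qed
  ultimately have quatQ: "quaternion_algebra Q"
    using unityQ by (auto simp: quaternion_algebra_def hurwitz_algebra_def Q_def C)
  have conjQ: "conj_std Q (f p) = f (h_cj p)" for p
    by (simp add: conj_std_def unity_eqI[OF unityQ] Qpolar e f_pol h_cj_eq[of p a] f_diff f_scl)
      (simp add: Q_def)
  have "is_iso (restrict_to A (centralizer A e)) (para_hurwitz Q) id"
    unfolding is_iso_def
  proof (intro conjI ballI allI)
    show "id (mul (restrict_to A (centralizer A e)) x y) = mul (para_hurwitz Q) (id x) (id y)"
      if xy: "x \<in> vecs (restrict_to A (centralizer A e))" "y \<in> vecs (restrict_to A (centralizer A e))" for x y
    proof -
      obtain p q where "x = f p" "y = f q"
        using xy unfolding restrict_to_simps C by blast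
      then show ?thesis
        by (simp add: para_hurwitz_def petersson_def conjQ) (simp add: Q_def f_mul' f_mul)
    qed
  qed (simp_all add: para_hurwitz_def petersson_def Q_def)
  then show "para_quaternion (restrict_to A (centralizer A e))"
    unfolding para_quaternion_def isomorphic_def using quatQ by blast
  define S where "S = range (\<lambda>k. \<psi> ((k, 0), 0))"
  note K = para_K_iso[OF \<psi>(1), folded S_def]
  have S: "S \<subseteq> range f" "S \<subseteq> vecs A"
    using CA by (auto simp: S_def f_def)
  have subS: "VA.subspace S"
    unfolding VA.subspace_def using K by blast
  show "contains_copy A (para_K :: ('f, 'f poly) qalg)"
    unfolding contains_copy_def is_subalgebra_def using K subS S by blast
  show "contains_copy (restrict_to A (centralizer A e)) (para_K :: ('f, 'f poly) qalg)"
    unfolding contains_copy_def is_subalgebra_def using K subS S C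
    by (intro exI[of _ S]) auto
qed

lemma quat_isometry:
  fixes A :: "('f::field, 'a::ab_group_add) qalg"
  assumes three: "(3::'f) \<noteq> 0"
    and \<psi>: "is_iso (model a b) A \<psi>" "\<psi> o_one = e" and \<rho>: "is_iso (model a' b') A \<rho>" "\<rho> o_one = f"
    and \<theta>: "is_iso (quaternion_of A e) (quaternion_of A f) \<theta>"
  obtains \<sigma> where "bij \<sigma>" "\<And>x y. \<sigma> (x + y) = \<sigma> x + \<sigma> y" "\<And>x. h_nrm a' (\<sigma> x) = h_nrm a x"
proof -
  have nrm: "h_nrm a p = nrm A (\<psi> (p, 0))" "h_nrm a' p = nrm A (\<rho> (p, 0))" for p
    using \<psi>(1) \<rho>(1) by (simp_all add: is_iso_def o_nrm_def dbl_nrm_def del: split_paired_All)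
      (simp_all add: h_defs)
  have inj: "inj (\<lambda>p. \<psi> (p, 0))" "inj (\<lambda>p. \<rho> (p, 0))"
  proof -
    have "inj \<psi>" "inj \<rho>"
      using \<psi>(1) \<rho>(1) by (simp_all add: is_iso_def bij_betw_def)
    then show "inj (\<lambda>p. \<psi> (p, 0))" "inj (\<lambda>p. \<rho> (p, 0))"
      by (auto intro!: injI simp: inj_eq)
  qed
  have add: "\<psi> (p + q, 0) = \<psi> (p, 0) + \<psi> (q, 0)" "\<rho> (p + q, 0) = \<rho> (p, 0) + \<rho> (q, 0)" for p q
  proof -
    have "\<psi> (x + y) = \<psi> x + \<psi> y" "\<rho> (x + y) = \<rho> x + \<rho> y" for x y
      using \<psi>(1) \<rho>(1) by (simp_all add: is_iso_def del: split_paired_All)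
    from this[of "(p, 0)" "(q, 0)"]
    show "\<psi> (p + q, 0) = \<psi> (p, 0) + \<psi> (q, 0)" "\<rho> (p + q, 0) = \<rho> (p, 0) + \<rho> (q, 0)"
      by simp_all
  qed
  have C: "centralizer A e = range (\<lambda>p. \<psi> (p, 0))" "centralizer A f = range (\<lambda>p. \<rho> (p, 0))"
    using centralizer_eq[OF three] \<psi> \<rho> by blast+
  have bij\<theta>: "bij_betw \<theta> (range (\<lambda>p. \<psi> (p, 0))) (range (\<lambda>p. \<rho> (p, 0)))"
    and \<theta>_add: "\<And>x y. x \<in> range (\<lambda>p. \<psi> (p, 0)) \<Longrightarrow> y \<in> range (\<lambda>p. \<psi> (p, 0)) \<Longrightarrow> \<theta> (x + y) = \<theta> x + \<theta> y"
    and \<theta>_nrm: "\<And>x. x \<in> range (\<lambda>p. \<psi> (p, 0)) \<Longrightarrow> nrm A (\<theta> x) = nrm A x"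
    using \<theta> unfolding is_iso_def quaternion_of_simps C by blast+
  define \<sigma> where "\<sigma> = inv (\<lambda>p. \<rho> (p, 0)) \<circ> (\<theta> \<circ> (\<lambda>p. \<psi> (p, 0)))"
  have "bij_betw (\<theta> \<circ> (\<lambda>p. \<psi> (p, 0))) UNIV (range (\<lambda>p. \<rho> (p, 0)))"
    using inj(1) bij\<theta> by (intro bij_betw_trans[of _ UNIV "range (\<lambda>p. \<psi> (p, 0))"]) (simp_all add: bij_betw_def)
  then have "bij \<sigma>"
    unfolding \<sigma>_def by (rule bij_betw_trans[OF _ bij_betw_inv_into[OF inj_on_imp_bij_betw[OF inj(2)]]])
  moreover have \<rho>\<sigma>: "\<rho> (\<sigma> p, 0) = \<theta> (\<psi> (p, 0))" for p
  proof -
    have "\<theta> (\<psi> (p, 0)) \<in> range (\<lambda>p. \<rho> (p, 0))"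
      using bij\<theta> by (auto simp: bij_betw_def)
    then have "(\<lambda>p. \<rho> (p, 0)) (inv (\<lambda>p. \<rho> (p, 0)) (\<theta> (\<psi> (p, 0)))) = \<theta> (\<psi> (p, 0))"
      by (rule f_inv_into_f)
    then show ?thesis
      by (simp add: \<sigma>_def)
  qed
  moreover have "\<sigma> (x + y) = \<sigma> x + \<sigma> y" for x y
  proof (rule injD[OF inj(2)])
    show "\<rho> (\<sigma> (x + y), 0) = \<rho> (\<sigma> x + \<sigma> y, 0)"
      by (simp add: add \<rho>\<sigma> \<theta>_add)
  qed
  moreover have "h_nrm a' (\<sigma> x) = h_nrm a x" for x
    by (simp add: nrm \<rho>\<sigma> \<theta>_nrm)
  ultimately show ?thesis
    using that by blast
qed

lemma conjugate_if_isomorphic: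
  fixes A :: "('f::field, 'a::ab_group_add) qalg" and h :: "'f \<Rightarrow> 'k::field"
  assumes A: "okubo_algebra h A" and three: "(3::'f) \<noteq> 0" and e: "is_idempotent A e" and f: "is_idempotent A f"
    and iso: "isomorphic (quaternion_of A e) (quaternion_of A f)"
  shows "conjugate A e f"
proof -
  obtain \<theta> where \<theta>: "is_iso (quaternion_of A e) (quaternion_of A f) \<theta>"
    using iso by (auto simp: isomorphic_def)
  obtain a b where m: "has_model A e a b"
    using has_model_exists(1)[OF A three e] by blast
  then obtain \<psi> where ab: "a \<noteq> 0" "b \<noteq> 0" and \<psi>: "is_iso (model a b) A \<psi>" "\<psi> o_one = e"
    by (auto simp: has_model_def)
  obtain a' b' where m': "has_model A f a' b'"
    using has_model_exists(1)[OF A three f] by blast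
  then obtain \<rho> where ab': "a' \<noteq> 0" "b' \<noteq> 0" and \<rho>: "is_iso (model a' b') A \<rho>" "\<rho> o_one = f"
    by (auto simp: has_model_def)
  obtain \<sigma> where \<sigma>: "bij \<sigma>" "\<And>x y. \<sigma> (x + y) = \<sigma> x + \<sigma> y" "\<And>x. h_nrm a' (\<sigma> x) = h_nrm a x"
    using quat_isometry[OF three \<psi> \<rho> \<theta>] by blast
  define s where "s x = (\<sigma> (fst x), \<sigma> (snd x))" for x
  define T where "T = (inv \<rho> \<circ> \<psi>) \<circ> inv s"
  have "\<exists>d. b = b' * h_nrm a' d"
  proof -
    interpret mult_form h_scl "h_nrm a'" "[((1, 0), 0), ((0, 1), 0), (0, (1, 0)), (0, (0, 1))]" "((1, 0), 0)"
      by (rule mult_form_h[OF three ab'(1)])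
    have bijs: "bij s"
    proof (rule o_bij[of "\<lambda>x. (inv \<sigma> (fst x), inv \<sigma> (snd x))"])
      show "(\<lambda>x. (inv \<sigma> (fst x), inv \<sigma> (snd x))) \<circ> s = id" "s \<circ> (\<lambda>x. (inv \<sigma> (fst x), inv \<sigma> (snd x))) = id"
        using \<sigma>(1) by (simp_all add: s_def fun_eq_iff bij_is_inj bij_is_surj surj_f_inv_f)
    qed
    have \<rho>\<psi>: "is_iso (model a b) (model a' b') (inv \<rho> \<circ> \<psi>)"
      using \<psi>(1) is_iso_inv_total[OF \<rho>(1)] by (auto intro: is_iso_comp)
    then have bij: "bij (inv \<rho> \<circ> \<psi>)" and add: "(inv \<rho> \<circ> \<psi>) (x + y) = (inv \<rho> \<circ> \<psi>) x + (inv \<rho> \<circ> \<psi>) y"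
      and nrm: "o_nrm a' b' ((inv \<rho> \<circ> \<psi>) x) = o_nrm a b x" for x y
      by (simp_all only: is_iso_def model_simps UNIV_I)
    have s_inv: "s (inv s x) = x" for x
      using bijs by (simp add: bij_is_surj surj_f_inv_f)
    have s_add: "s (x + y) = s x + s y" for x y
      by (simp add: s_def \<sigma>(2))
    show ?thesis
    proof (rule cancellation[of b b' T])
      show "bij T"
        unfolding T_def by (rule bij_comp[OF bij_imp_bij_inv[OF bijs] bij])
      show "T (x + y) = T x + T y" for x y
      proof -
        have "inv s (x + y) = inv s x + inv s y"
        proof (rule injD[OF bij_is_inj[OF bijs]])
          show "s (inv s (x + y)) = s (inv s x + inv s y)"
            by (simp add: s_add s_inv)
        qed
        then show ?thesis
          unfolding T_def using add by simp
      qed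
      show "dbl_nrm b' (h_nrm a') (T x) = dbl_nrm b (h_nrm a') x" for x
      proof -
        have "dbl_nrm b' (h_nrm a') (T x) = dbl_nrm b (h_nrm a) (inv s x)"
          using nrm[of "inv s x"] by (simp add: T_def o_nrm_def)
        also have "\<dots> = dbl_nrm b (h_nrm a') (s (inv s x))"
          by (simp add: dbl_nrm_def s_def \<sigma>(3))
        finally show ?thesis
          by (simp only: s_inv)
      qed
    qed (use ab ab' in auto)
  qed
  then obtain d where d: "b = b' * h_nrm a' d"
    by blast
  then obtain a2 where m2: "has_model A f a2 b"
    using has_model_exists(2)[OF A three f m', of d] ab by auto
  then obtain \<rho>2 where a2: "a2 \<noteq> 0" and \<rho>2: "is_iso (model a2 b) A \<rho>2" "\<rho>2 o_one = f"
    by (auto simp: has_model_def)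
  obtain \<tau> where \<tau>: "bij \<tau>" "\<And>x y. \<tau> (x + y) = \<tau> x + \<tau> y" "\<And>x. h_nrm a2 (\<tau> x) = h_nrm a x"
    using quat_isometry[OF three \<psi> \<rho>2 \<theta>] by blast
  interpret mult_form k_scl "k_nrm :: 'f quad \<Rightarrow> 'f" "[(1, 0), (0, 1)]" "(1, 0)"
    by (rule mult_form_k[OF three])
  obtain k where k: "a = a2 * k_nrm k"
    using cancellation[of a a2 \<tau>] ab(1) a2 \<tau> unfolding h_nrm_def by blast
  then have "has_model A f a b"
    using has_model_rescale[OF m2, of k] ab(1) by auto
  then show ?thesis
    by (rule has_model_conjugate[OF m])
qed

lemma isomorphic_if_conjugate:
  assumes "conjugate A e f" and e: "e \<in> vecs A" and closed: "\<And>x y. x \<in> vecs A \<Longrightarrow> y \<in> vecs A \<Longrightarrow> mul A x y \<in> vecs A"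
  shows "isomorphic (quaternion_of A e) (quaternion_of A f)"
proof -
  obtain \<phi> where \<phi>: "is_iso A A \<phi>" "\<phi> e = f"
    using assms(1) by (auto simp: conjugate_def)
  have bij: "bij_betw \<phi> (vecs A) (vecs A)" 
    and mul: "\<And>x y. x \<in> vecs A \<Longrightarrow> y \<in> vecs A \<Longrightarrow> \<phi> (mul A x y) = mul A (\<phi> x) (\<phi> y)"
    using \<phi> by (simp_all add: is_iso_def)
  have C: "\<phi> x \<in> centralizer A f \<longleftrightarrow> x \<in> centralizer A e" if x: "x \<in> vecs A" for x
  proof -
    have "\<phi> x \<in> centralizer A f \<longleftrightarrow> \<phi> (mul A e x) = \<phi> (mul A x e)"
      using bij x by (auto simp: centralizer_def mul e \<phi>(2) dest: bij_betwE)
    also have "\<dots> \<longleftrightarrow> mul A e x = mul A x e"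
      using bij closed e x by (metis bij_betw_inv_into_left)
    finally show ?thesis
      using x by (simp add: centralizer_def)
  qed
  have sub: "centralizer A g \<subseteq> vecs A" for g
    by (auto simp: centralizer_def)
  have "bij_betw \<phi> (centralizer A e) (centralizer A f)"
  proof (rule bij_betw_imageI)
    show "inj_on \<phi> (centralizer A e)"
      using bij sub by (auto simp: bij_betw_def intro: inj_on_subset)
    show "\<phi> ` centralizer A e = centralizer A f"
    proof
      show "centralizer A f \<subseteq> \<phi> ` centralizer A e"
      proof
        fix y assume y: "y \<in> centralizer A f"
        then obtain x where "x \<in> vecs A" "y = \<phi> x"
          using sub bij by (metis bij_betw_imp_surj_on imageE subsetD)
        then show "y \<in> \<phi> ` centralizer A e"
          using C y by blast
      qed
    qed (use C sub in blast)
  qed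
  then have "is_iso (quaternion_of A e) (quaternion_of A f) \<phi>"
    using \<phi> closed e subsetD[OF sub] by (simp add: is_iso_def)
  then show ?thesis
    by (auto simp: isomorphic_def)
qed

lemma conjugate_if_cube_root:
  fixes A :: "('f::field, 'a::ab_group_add) qalg" and h :: "'f \<Rightarrow> 'k::field"
  assumes A: "okubo_algebra h A" and three: "(3::'f) \<noteq> 0" and e: "is_idempotent A e" and f: "is_idempotent A f"
    and \<omega>: "(\<omega>::'f) ^ 3 = 1" "\<omega> \<noteq> 1"
  shows "conjugate A e f"
proof -
  interpret mult_form k_scl "k_nrm :: 'f quad \<Rightarrow> 'f" "[(1, 0), (0, 1)]" "(1, 0)"
    by (rule mult_form_k[OF three])
  have "(\<omega> - 1) * (\<omega>\<^sup>2 + \<omega> + 1) = 0"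
    using \<omega>(1) by (simp add: power2_eq_square power3_eq_cube algebra_simps)
  then have "k_nrm (- \<omega>, 1) = 0"
    using \<omega>(2) by (simp add: k_nrm_def)
  then have univ: "\<exists>k :: 'f quad. k_nrm k = c" for c
    by (rule universal_if_isotropic[rotated]) (simp add: zero_prod_def)
  have "has_model A g 1 1" if g: "is_idempotent A g" for g
  proof -
    obtain a b where m: "has_model A g a b"
      using has_model_exists(1)[OF A three g] by blast
    then have b: "b \<noteq> 0"
      by (simp add: has_model_def)
    obtain k :: "'f quad" where k: "k_nrm k = 1 / b"
      using univ by blast
    have "h_nrm a (k, 0) = 1 / b"
      by (simp add: h_nrm_def dbl_nrm_def k)
    then obtain a' where m': "has_model A g a' 1"
      using has_model_exists(2)[OF A three g m, of "(k, 0)"] b by auto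
    then have a': "a' \<noteq> 0"
      by (simp add: has_model_def)
    obtain l :: "'f quad" where "k_nrm l = 1 / a'"
      using univ by blast
    then show ?thesis
      using has_model_rescale[OF m', of l] a' by simp
  qed
  then show ?thesis
    using e f has_model_conjugate by blast
qed

theorem corollary5p8:
  fixes A :: "('f::field, 'a::ab_group_add) qalg" and h :: "'f \<Rightarrow> 'k::field"
  assumes "CHAR('f) \<noteq> 3" and "okubo_algebra h A"
  shows "((\<exists>e. is_idempotent A e) \<longleftrightarrow> contains_copy A (para_K :: ('f, 'f poly) qalg)) \<and>
    ((\<exists>e. is_idempotent A e) \<longrightarrow>
      (\<forall>e. is_idempotent A e \<longrightarrow>
         is_subalgebra (centralizer A e) A \<and>
         para_quaternion (restrict_to A (centralizer A e)) \<and>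
         contains_copy (restrict_to A (centralizer A e)) (para_K :: ('f, 'f poly) qalg)) \<and>
      (\<forall>e f. is_idempotent A e \<longrightarrow> is_idempotent A f \<longrightarrow>
         (conjugate A e f \<longleftrightarrow> isomorphic (quaternion_of A e) (quaternion_of A f))) \<and>
      ((\<exists>\<omega>::'f. \<omega> ^ 3 = 1 \<and> \<omega> \<noteq> 1) \<longrightarrow> (\<exists>!C. C \<in> idempotent_classes A)))"
proof -
  note three = three_nonzero[OF assms(1)] and A = assms(2)
  have awf: "algebra_with_form A"
    using A by (simp add: okubo_algebra_def)
  then have closed: "mul A x y \<in> vecs A" if "x \<in> vecs A" "y \<in> vecs A" for x y
    using that by (simp add: algebra_with_form_def bilinear_product_def)
  have model: "\<exists>a b. has_model A e a b" if "is_idempotent A e" for e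
    using has_model_exists(1)[OF A three that] .
  have classes: "\<exists>!C. C \<in> idempotent_classes A"
    if e: "is_idempotent A e" and \<omega>: "(\<omega>::'f) ^ 3 = 1" "\<omega> \<noteq> 1" for e \<omega>
  proof -
    have *: "{(e, f). is_idempotent A e \<and> is_idempotent A f \<and> conjugate A e f} `` {g} = {f. is_idempotent A f}"
      if "is_idempotent A g" for g
      using that conjugate_if_cube_root[OF A three _ _ \<omega>] by blast
    have "idempotent_classes A = {{f. is_idempotent A f}}"
      unfolding idempotent_classes_def quotient_def using * e by auto
    then show ?thesis by simp
  qed
  show ?thesis
  proof (intro conjI impI allI)
    show "(\<exists>e. is_idempotent A e) \<longleftrightarrow> contains_copy A (para_K :: ('f, 'f poly) qalg)"
      using model centralizer_properties(4)[OF awf three] idempotent_of_copy by blast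
    show "is_subalgebra (centralizer A e) A" "para_quaternion (restrict_to A (centralizer A e))"
      "contains_copy (restrict_to A (centralizer A e)) (para_K :: ('f, 'f poly) qalg)"
      if "is_idempotent A e" for e
      using model[OF that] centralizer_properties[OF awf three] by blast+
    show "conjugate A e f \<longleftrightarrow> isomorphic (quaternion_of A e) (quaternion_of A f)"
      if "is_idempotent A e" "is_idempotent A f" for e f
      using conjugate_if_isomorphic[OF A three that] isomorphic_if_conjugate[of A e f] closed that
      by (auto simp: is_idempotent_def)
    show "\<exists>!C. C \<in> idempotent_classes A"
      if "\<exists>e. is_idempotent A e" "\<exists>\<omega>::'f. \<omega> ^ 3 = 1 \<and> \<omega> \<noteq> 1"
      using that classes by blast
  qed
qed

end
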